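(* Let $R$ be a discrete valuation ring with fixed uniformizer $t$ and let $X=(X,c)$ be any cyclic poset. Then $\mathcal{MF}(X)$ is a Frobenius category, where a sequence $(A,d)\to(B,d)\to(C,d)$ is defined to be exact in $\mathcal{MF}(X)$ if $A\to B\to C$ is (split) exact in $\mathcal P(X)$. The objects isomorphic to $GP$ for some $P$ in $\mathcal P(X)$ are the projective-injective objects of $\mathcal{MF}(X)$.
   Context: $\mathbb N=\{0,1,2,\dots\}$. A cyclic poset is a pair $(X,c)$ where $X$ is a set and $c:X^3\to\mathbb N$ is a reduced cocycle: $c(xyz)-c(wyz)+c(wxz)-c(wxy)=0$ and $c(xxy)=c(xyy)=0$ for all $w,x,y,z\in X$. $RX$ is the $R$-category with objects $P_x$, $x\in X$, with $RX(P_x,P_y)$ the free $R$-module on one generator $f_{xy}$, and composition $(rf_{yz})\circ(sf_{xy})=rst^{c(xyz)}f_{xz}$. $\mathcal P(X)=\mathrm{add}\,RX$ is the additive $R$-category generated by $RX$ (finite direct sums of the $P_x$). $\mathcal{MF}(X)$ is the category of all pairs $(P,d)$ with $P\in\mathcal P(X)$ and $d:P\to P$ such that $d^2$ is multiplication by $t$; morphisms $(P,d)\to(Q,d)$ are morphisms $f:P\to Q$ in $\mathcal P(X)$ with $df=fd$. For $P\in\mathcal P(X)$, $GP=\left(P\oplus P,\begin{bmatrix}0&t\\1&0\end{bmatrix}\right)$. A Frobenius category is an exact category with enough projectives and enough injectives in which projectives and injectives coincide. *)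

theory Defs
  imports "Jordan_Normal_Form.Matrix"
begin

section \<open>Discrete valuation rings\<close>

definition ring_ideal :: "'r::comm_ring_1 set \<Rightarrow> bool" where
  "ring_ideal I \<longleftrightarrow> 0 \<in> I \<and> (\<forall>a\<in>I. \<forall>b\<in>I. a + b \<in> I) \<and> (\<forall>r. \<forall>a\<in>I. r * a \<in> I)"

definition generated_ideal :: "'r::comm_ring_1 \<Rightarrow> 'r set" where
  "generated_ideal a = {r * a |r. True}"

definition maximal_ring_ideal :: "'r::comm_ring_1 set \<Rightarrow> bool" where
  "maximal_ring_ideal M \<longleftrightarrow> ring_ideal M \<and> M \<noteq> UNIV \<and>
     (\<forall>I. ring_ideal I \<longrightarrow> M \<subseteq> I \<longrightarrow> I = M \<or> I = UNIV)"

text \<open>A local principal ideal domain that is not a field.\<close>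

definition discrete_valuation_ring :: "'r::idom itself \<Rightarrow> bool" where
  "discrete_valuation_ring _ \<longleftrightarrow>
     (\<forall>I :: 'r set. ring_ideal I \<longrightarrow> (\<exists>a. I = generated_ideal a)) \<and>
     (\<exists>!M :: 'r set. maximal_ring_ideal M) \<and>
     (\<exists>x :: 'r. x \<noteq> 0 \<and> \<not> x dvd 1)"

definition uniformizer :: "'r::idom \<Rightarrow> bool" where
  "uniformizer t \<longleftrightarrow> maximal_ring_ideal (generated_ideal t)"


section \<open>Additive and linear categories\<close>

text \<open>Hom sets for different pairs of objects need not be disjoint, so every operation takes the
  objects involved as arguments: \<open>Comp C X Y Z g f\<close> is the composite of
  \<open>f : X \<rightarrow> Y\<close> and \<open>g : Y \<rightarrow> Z\<close>.\<close>

record ('o, 'm) precat =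
  Obj :: "'o set"
  Hom :: "'o \<Rightarrow> 'o \<Rightarrow> 'm set"
  Idn :: "'o \<Rightarrow> 'm"
  Comp :: "'o \<Rightarrow> 'o \<Rightarrow> 'o \<Rightarrow> 'm \<Rightarrow> 'm \<Rightarrow> 'm"
  Zero :: "'o \<Rightarrow> 'o \<Rightarrow> 'm"
  Plus :: "'o \<Rightarrow> 'o \<Rightarrow> 'm \<Rightarrow> 'm \<Rightarrow> 'm"

record ('r, 'o, 'm) lincat = "('o, 'm) precat" +
  Scale :: "'o \<Rightarrow> 'o \<Rightarrow> 'r \<Rightarrow> 'm \<Rightarrow> 'm"

locale preadditive_category =
  fixes C :: "('o, 'm, 'z) precat_scheme"
  assumes Idn_in: "X \<in> Obj C \<Longrightarrow> Idn C X \<in> Hom C X X"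
    and Comp_in: "\<lbrakk>X \<in> Obj C; Y \<in> Obj C; Z \<in> Obj C; f \<in> Hom C X Y; g \<in> Hom C Y Z\<rbrakk>
      \<Longrightarrow> Comp C X Y Z g f \<in> Hom C X Z"
    and Idn_left: "\<lbrakk>X \<in> Obj C; Y \<in> Obj C; f \<in> Hom C X Y\<rbrakk> \<Longrightarrow> Comp C X Y Y (Idn C Y) f = f"
    and Idn_right: "\<lbrakk>X \<in> Obj C; Y \<in> Obj C; f \<in> Hom C X Y\<rbrakk> \<Longrightarrow> Comp C X X Y f (Idn C X) = f"
    and Comp_assoc: "\<lbrakk>W \<in> Obj C; X \<in> Obj C; Y \<in> Obj C; Z \<in> Obj C;
        f \<in> Hom C W X; g \<in> Hom C X Y; h \<in> Hom C Y Z\<rbrakk>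
      \<Longrightarrow> Comp C W X Z (Comp C X Y Z h g) f = Comp C W Y Z h (Comp C W X Y g f)"
    and Zero_in: "\<lbrakk>X \<in> Obj C; Y \<in> Obj C\<rbrakk> \<Longrightarrow> Zero C X Y \<in> Hom C X Y"
    and Plus_in: "\<lbrakk>X \<in> Obj C; Y \<in> Obj C; f \<in> Hom C X Y; g \<in> Hom C X Y\<rbrakk>
      \<Longrightarrow> Plus C X Y f g \<in> Hom C X Y"
    and Plus_assoc: "\<lbrakk>X \<in> Obj C; Y \<in> Obj C; f \<in> Hom C X Y; g \<in> Hom C X Y; h \<in> Hom C X Y\<rbrakk>
      \<Longrightarrow> Plus C X Y (Plus C X Y f g) h = Plus C X Y f (Plus C X Y g h)"
    and Plus_comm: "\<lbrakk>X \<in> Obj C; Y \<in> Obj C; f \<in> Hom C X Y; g \<in> Hom C X Y\<rbrakk>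
      \<Longrightarrow> Plus C X Y f g = Plus C X Y g f"
    and Plus_zero: "\<lbrakk>X \<in> Obj C; Y \<in> Obj C; f \<in> Hom C X Y\<rbrakk> \<Longrightarrow> Plus C X Y f (Zero C X Y) = f"
    and Plus_inverse: "\<lbrakk>X \<in> Obj C; Y \<in> Obj C; f \<in> Hom C X Y\<rbrakk>
      \<Longrightarrow> \<exists>g\<in>Hom C X Y. Plus C X Y f g = Zero C X Y"
    and Comp_Plus_left: "\<lbrakk>X \<in> Obj C; Y \<in> Obj C; Z \<in> Obj C;
        f \<in> Hom C X Y; g \<in> Hom C Y Z; h \<in> Hom C Y Z\<rbrakk>
      \<Longrightarrow> Comp C X Y Z (Plus C Y Z g h) f = Plus C X Z (Comp C X Y Z g f) (Comp C X Y Z h f)"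
    and Comp_Plus_right: "\<lbrakk>X \<in> Obj C; Y \<in> Obj C; Z \<in> Obj C;
        f \<in> Hom C X Y; g \<in> Hom C X Y; h \<in> Hom C Y Z\<rbrakk>
      \<Longrightarrow> Comp C X Y Z h (Plus C X Y f g) = Plus C X Z (Comp C X Y Z h f) (Comp C X Y Z h g)"

locale linear_category = preadditive_category C
  for C :: "('r::comm_ring_1, 'o, 'm) lincat" +
  assumes Scale_in: "\<lbrakk>X \<in> Obj C; Y \<in> Obj C; f \<in> Hom C X Y\<rbrakk> \<Longrightarrow> Scale C X Y r f \<in> Hom C X Y"
    and Scale_Plus: "\<lbrakk>X \<in> Obj C; Y \<in> Obj C; f \<in> Hom C X Y; g \<in> Hom C X Y\<rbrakk>
      \<Longrightarrow> Scale C X Y r (Plus C X Y f g) = Plus C X Y (Scale C X Y r f) (Scale C X Y r g)"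
    and Scale_add: "\<lbrakk>X \<in> Obj C; Y \<in> Obj C; f \<in> Hom C X Y\<rbrakk>
      \<Longrightarrow> Scale C X Y (r + s) f = Plus C X Y (Scale C X Y r f) (Scale C X Y s f)"
    and Scale_mult: "\<lbrakk>X \<in> Obj C; Y \<in> Obj C; f \<in> Hom C X Y\<rbrakk>
      \<Longrightarrow> Scale C X Y (r * s) f = Scale C X Y r (Scale C X Y s f)"
    and Scale_one: "\<lbrakk>X \<in> Obj C; Y \<in> Obj C; f \<in> Hom C X Y\<rbrakk> \<Longrightarrow> Scale C X Y 1 f = f"
    and Comp_Scale_left: "\<lbrakk>X \<in> Obj C; Y \<in> Obj C; Z \<in> Obj C; f \<in> Hom C X Y; g \<in> Hom C Y Z\<rbrakk>
      \<Longrightarrow> Comp C X Y Z (Scale C Y Z r g) f = Scale C X Z r (Comp C X Y Z g f)"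
    and Comp_Scale_right: "\<lbrakk>X \<in> Obj C; Y \<in> Obj C; Z \<in> Obj C; f \<in> Hom C X Y; g \<in> Hom C Y Z\<rbrakk>
      \<Longrightarrow> Comp C X Y Z g (Scale C X Y r f) = Scale C X Z r (Comp C X Y Z g f)"

definition zero_object :: "('o, 'm, 'z) precat_scheme \<Rightarrow> 'o \<Rightarrow> bool" where
  "zero_object C Z \<longleftrightarrow> Z \<in> Obj C \<and>
     (\<forall>X\<in>Obj C. Hom C X Z = {Zero C X Z} \<and> Hom C Z X = {Zero C Z X})"

definition is_biproduct ::
    "('o, 'm, 'z) precat_scheme \<Rightarrow> 'o \<Rightarrow> 'o \<Rightarrow> 'o \<Rightarrow> 'm \<Rightarrow> 'm \<Rightarrow> 'm \<Rightarrow> 'm \<Rightarrow> bool" where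
  "is_biproduct C A B S i\<^sub>1 i\<^sub>2 p\<^sub>1 p\<^sub>2 \<longleftrightarrow>
     A \<in> Obj C \<and> B \<in> Obj C \<and> S \<in> Obj C \<and>
     i\<^sub>1 \<in> Hom C A S \<and> i\<^sub>2 \<in> Hom C B S \<and> p\<^sub>1 \<in> Hom C S A \<and> p\<^sub>2 \<in> Hom C S B \<and>
     Comp C A S A p\<^sub>1 i\<^sub>1 = Idn C A \<and> Comp C B S B p\<^sub>2 i\<^sub>2 = Idn C B \<and>
     Comp C A S B p\<^sub>2 i\<^sub>1 = Zero C A B \<and> Comp C B S A p\<^sub>1 i\<^sub>2 = Zero C B A \<and>
     Plus C S S (Comp C S A S i\<^sub>1 p\<^sub>1) (Comp C S B S i\<^sub>2 p\<^sub>2) = Idn C S"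

definition additive_category :: "('o, 'm, 'z) precat_scheme \<Rightarrow> bool" where
  "additive_category C \<longleftrightarrow> preadditive_category C \<and> (\<exists>Z. zero_object C Z) \<and>
     (\<forall>A\<in>Obj C. \<forall>B\<in>Obj C. \<exists>S i\<^sub>1 i\<^sub>2 p\<^sub>1 p\<^sub>2. is_biproduct C A B S i\<^sub>1 i\<^sub>2 p\<^sub>1 p\<^sub>2)"

definition is_iso :: "('o, 'm, 'z) precat_scheme \<Rightarrow> 'o \<Rightarrow> 'o \<Rightarrow> 'm \<Rightarrow> bool" where
  "is_iso C A B f \<longleftrightarrow> A \<in> Obj C \<and> B \<in> Obj C \<and> f \<in> Hom C A B \<and>
     (\<exists>g\<in>Hom C B A. Comp C A B A g f = Idn C A \<and> Comp C B A B f g = Idn C B)"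

definition isomorphic :: "('o, 'm, 'z) precat_scheme \<Rightarrow> 'o \<Rightarrow> 'o \<Rightarrow> bool" where
  "isomorphic C A B \<longleftrightarrow> (\<exists>f. is_iso C A B f)"

text \<open>The sequence \<open>f : A \<rightarrow> B\<close>, \<open>g : B \<rightarrow> D\<close> is split exact if it is the inclusion
  of the first and the projection onto the second summand of a decomposition of \<open>B\<close> as a
  direct sum of \<open>A\<close> and \<open>D\<close>.\<close>

definition split_exact ::
    "('o, 'm, 'z) precat_scheme \<Rightarrow> 'o \<Rightarrow> 'o \<Rightarrow> 'o \<Rightarrow> 'm \<Rightarrow> 'm \<Rightarrow> bool" where
  "split_exact C A B D f g \<longleftrightarrow> (\<exists>s r. is_biproduct C A D B f s r g)"


section \<open>Exact categories and Frobenius categories\<close>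

definition is_kernel ::
    "('o, 'm, 'z) precat_scheme \<Rightarrow> 'o \<Rightarrow> 'o \<Rightarrow> 'o \<Rightarrow> 'm \<Rightarrow> 'm \<Rightarrow> bool" where
  "is_kernel C A B D i p \<longleftrightarrow> Comp C A B D p i = Zero C A D \<and>
     (\<forall>T\<in>Obj C. \<forall>h\<in>Hom C T B. Comp C T B D p h = Zero C T D \<longrightarrow>
        (\<exists>!k. k \<in> Hom C T A \<and> Comp C T A B i k = h))"

definition is_cokernel ::
    "('o, 'm, 'z) precat_scheme \<Rightarrow> 'o \<Rightarrow> 'o \<Rightarrow> 'o \<Rightarrow> 'm \<Rightarrow> 'm \<Rightarrow> bool" where
  "is_cokernel C A B D i p \<longleftrightarrow> Comp C A B D p i = Zero C A D \<and>
     (\<forall>T\<in>Obj C. \<forall>h\<in>Hom C B T. Comp C A B T h i = Zero C A T \<longrightarrow>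
        (\<exists>!k. k \<in> Hom C D T \<and> Comp C B D T k p = h))"

definition kernel_cokernel_pair ::
    "('o, 'm, 'z) precat_scheme \<Rightarrow> 'o \<Rightarrow> 'o \<Rightarrow> 'o \<Rightarrow> 'm \<Rightarrow> 'm \<Rightarrow> bool" where
  "kernel_cokernel_pair C A B D i p \<longleftrightarrow>
     A \<in> Obj C \<and> B \<in> Obj C \<and> D \<in> Obj C \<and> i \<in> Hom C A B \<and> p \<in> Hom C B D \<and>
     is_kernel C A B D i p \<and> is_cokernel C A B D i p"

text \<open>Pushout of \<open>i : A \<rightarrow> B\<close> and \<open>f : A \<rightarrow> A'\<close>, given by
  \<open>i' : A' \<rightarrow> B'\<close> and \<open>f' : B \<rightarrow> B'\<close>.\<close>

definition is_pushout ::
    "('o, 'm, 'z) precat_scheme \<Rightarrow> 'o \<Rightarrow> 'o \<Rightarrow> 'o \<Rightarrow> 'o \<Rightarrow> 'm \<Rightarrow> 'm \<Rightarrow> 'm \<Rightarrow> 'm \<Rightarrow> bool" where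
  "is_pushout C A B A' B' i f i' f' \<longleftrightarrow>
     B' \<in> Obj C \<and> i' \<in> Hom C A' B' \<and> f' \<in> Hom C B B' \<and>
     Comp C A B B' f' i = Comp C A A' B' i' f \<and>
     (\<forall>T\<in>Obj C. \<forall>u\<in>Hom C B T. \<forall>v\<in>Hom C A' T. Comp C A B T u i = Comp C A A' T v f \<longrightarrow>
        (\<exists>!k. k \<in> Hom C B' T \<and> Comp C B B' T k f' = u \<and> Comp C A' B' T k i' = v))"

text \<open>Pullback of \<open>p : B \<rightarrow> D\<close> and \<open>f : D' \<rightarrow> D\<close>, given by
  \<open>p' : B' \<rightarrow> D'\<close> and \<open>f' : B' \<rightarrow> B\<close>.\<close>

definition is_pullback ::
    "('o, 'm, 'z) precat_scheme \<Rightarrow> 'o \<Rightarrow> 'o \<Rightarrow> 'o \<Rightarrow> 'o \<Rightarrow> 'm \<Rightarrow> 'm \<Rightarrow> 'm \<Rightarrow> 'm \<Rightarrow> bool" where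
  "is_pullback C B D B' D' p f p' f' \<longleftrightarrow>
     B' \<in> Obj C \<and> p' \<in> Hom C B' D' \<and> f' \<in> Hom C B' B \<and>
     Comp C B' B D p f' = Comp C B' D' D f p' \<and>
     (\<forall>T\<in>Obj C. \<forall>u\<in>Hom C T B. \<forall>v\<in>Hom C T D'. Comp C T B D p u = Comp C T D' D f v \<longrightarrow>
        (\<exists>!k. k \<in> Hom C T B' \<and> Comp C T B' B f' k = u \<and> Comp C T B' D' p' k = v))"

text \<open>A class of exact sequences: \<open>E A B D i p\<close> means that
  \<open>A \<rightarrow> B \<rightarrow> D\<close> with maps \<open>i\<close> and \<open>p\<close> belongs to the class.\<close>

type_synonym ('o, 'm) seq_class = "'o \<Rightarrow> 'o \<Rightarrow> 'o \<Rightarrow> 'm \<Rightarrow> 'm \<Rightarrow> bool"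

definition inflation :: "('o, 'm) seq_class \<Rightarrow> 'o \<Rightarrow> 'o \<Rightarrow> 'm \<Rightarrow> bool" where
  "inflation E A B i \<longleftrightarrow> (\<exists>D p. E A B D i p)"

definition deflation :: "('o, 'm) seq_class \<Rightarrow> 'o \<Rightarrow> 'o \<Rightarrow> 'm \<Rightarrow> bool" where
  "deflation E B D p \<longleftrightarrow> (\<exists>A i. E A B D i p)"

text \<open>Exact categories in the sense of Quillen.\<close>

locale exact_category =
  fixes C :: "('o, 'm, 'z) precat_scheme" and E :: "('o, 'm) seq_class"
  assumes additive: "additive_category C"
    and exact_pair: "E A B D i p \<Longrightarrow> kernel_cokernel_pair C A B D i p"
    and exact_iso: "\<lbrakk>E A B D i p; is_iso C A A' a; is_iso C B B' b; is_iso C D D' d;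
        i' \<in> Hom C A' B'; p' \<in> Hom C B' D';
        Comp C A B B' b i = Comp C A A' B' i' a; Comp C B D D' d p = Comp C B B' D' p' b\<rbrakk>
      \<Longrightarrow> E A' B' D' i' p'"
    and inflation_Idn: "A \<in> Obj C \<Longrightarrow> inflation E A A (Idn C A)"
    and deflation_Idn: "A \<in> Obj C \<Longrightarrow> deflation E A A (Idn C A)"
    and inflation_Comp: "\<lbrakk>inflation E A B i; inflation E B D j\<rbrakk>
      \<Longrightarrow> inflation E A D (Comp C A B D j i)"
    and deflation_Comp: "\<lbrakk>deflation E A B p; deflation E B D q\<rbrakk>
      \<Longrightarrow> deflation E A D (Comp C A B D q p)"
    and inflation_pushout: "\<lbrakk>inflation E A B i; A' \<in> Obj C; f \<in> Hom C A A'\<rbrakk>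
      \<Longrightarrow> \<exists>B' i' f'. is_pushout C A B A' B' i f i' f' \<and> inflation E A' B' i'"
    and deflation_pullback: "\<lbrakk>deflation E B D p; D' \<in> Obj C; f \<in> Hom C D' D\<rbrakk>
      \<Longrightarrow> \<exists>B' p' f'. is_pullback C B D B' D' p f p' f' \<and> deflation E B' D' p'"

definition projective_object ::
    "('o, 'm, 'z) precat_scheme \<Rightarrow> ('o, 'm) seq_class \<Rightarrow> 'o \<Rightarrow> bool" where
  "projective_object C E P \<longleftrightarrow> P \<in> Obj C \<and>
     (\<forall>B D p h. deflation E B D p \<longrightarrow> h \<in> Hom C P D \<longrightarrow>
        (\<exists>k\<in>Hom C P B. Comp C P B D p k = h))"

definition injective_object ::
    "('o, 'm, 'z) precat_scheme \<Rightarrow> ('o, 'm) seq_class \<Rightarrow> 'o \<Rightarrow> bool" where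
  "injective_object C E I \<longleftrightarrow> I \<in> Obj C \<and>
     (\<forall>A B i h. inflation E A B i \<longrightarrow> h \<in> Hom C A I \<longrightarrow>
        (\<exists>k\<in>Hom C B I. Comp C A B I k i = h))"

locale frobenius_category = exact_category C E
  for C :: "('o, 'm, 'z) precat_scheme" and E :: "('o, 'm) seq_class" +
  assumes enough_projectives:
      "A \<in> Obj C \<Longrightarrow> \<exists>P p. projective_object C E P \<and> deflation E P A p"
    and enough_injectives:
      "A \<in> Obj C \<Longrightarrow> \<exists>I i. injective_object C E I \<and> inflation E A I i"
    and projective_iff_injective: "projective_object C E A \<longleftrightarrow> injective_object C E A"


section \<open>Cyclic posets and matrix factorizations\<close>

definition cyclic_poset :: "'x set \<Rightarrow> ('x \<Rightarrow> 'x \<Rightarrow> 'x \<Rightarrow> nat) \<Rightarrow> bool" where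
  "cyclic_poset X c \<longleftrightarrow>
     (\<forall>w\<in>X. \<forall>x\<in>X. \<forall>y\<in>X. \<forall>z\<in>X.
        int (c x y z) - int (c w y z) + int (c w x z) - int (c w x y) = 0) \<and>
     (\<forall>x\<in>X. \<forall>y\<in>X. c x x y = 0 \<and> c x y y = 0)"

text \<open>The category \<open>RX\<close>. The object \<open>P\<^sub>x\<close> is represented by \<open>x\<close>, and the morphism
  \<open>r f\<^sub>x\<^sub>y\<close> by its coefficient \<open>r\<close>. Since the cocycle is reduced, \<open>f\<^sub>x\<^sub>x\<close> is
  the identity.\<close>

definition RX :: "'r::comm_ring_1 \<Rightarrow> 'x set \<Rightarrow> ('x \<Rightarrow> 'x \<Rightarrow> 'x \<Rightarrow> nat) \<Rightarrow> ('r, 'x, 'r) lincat" where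
  "RX t X c = \<lparr>
     Obj = X,
     Hom = (\<lambda>x y. UNIV),
     Idn = (\<lambda>x. 1),
     Comp = (\<lambda>x y z r s. r * s * t ^ c x y z),
     Zero = (\<lambda>x y. 0),
     Plus = (\<lambda>x y r s. r + s),
     Scale = (\<lambda>x y a r. a * r)\<rparr>"

lemma linear_category_RX:
  assumes "cyclic_poset X c"
  shows "linear_category (RX t X c)"
proof -
  have "c x y z + c w x z = c w x y + c w y z"
    if "w \<in> X" "x \<in> X" "y \<in> X" "z \<in> X" for w x y z
  proof -
    have "int (c x y z) - int (c w y z) + int (c w x z) - int (c w x y) = 0"
      using assms that unfolding cyclic_poset_def by blast
    then show ?thesis by linarith
  qed
  then have pow: "t ^ c x y z * t ^ c w x z = t ^ c w x y * t ^ c w y z"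
    if "w \<in> X" "x \<in> X" "y \<in> X" "z \<in> X" for w x y z
    using that by (simp flip: power_add)
  show ?thesis
  proof (unfold_locales, goal_cases)
    case (5 W X' Y Z f g h)
    then have "t ^ c X' Y Z * t ^ c W X' Z = t ^ c W X' Y * t ^ c W Y Z"
      by (intro pow) (auto simp: RX_def)
    then have "h * g * f * (t ^ c X' Y Z * t ^ c W X' Z) = h * g * f * (t ^ c W X' Y * t ^ c W Y Z)"
      by simp
    then show ?case
      by (simp add: RX_def mult_ac)
  next
    case (11 X' Y f)
    show ?case
      by (auto simp: RX_def intro!: exI[of _ "- f"])
  qed (use assms in \<open>auto simp: RX_def cyclic_poset_def algebra_simps\<close>)
qed

definition hom_sum :: "('r, 'o, 'm) lincat \<Rightarrow> 'o \<Rightarrow> 'o \<Rightarrow> 'm list \<Rightarrow> 'm" where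
  "hom_sum C x y fs = foldr (Plus C x y) fs (Zero C x y)"

text \<open>The additive category generated by a linear category: an object is a formal finite direct sum,
  given by the list of its summands, and a morphism \<open>xs \<rightarrow> ys\<close> is a matrix whose entry in
  row \<open>j\<close> and column \<open>i\<close> is a morphism \<open>xs ! i \<rightarrow> ys ! j\<close>.\<close>

definition add_cat :: "('r, 'o, 'm) lincat \<Rightarrow> ('r, 'o list, 'm mat) lincat" where
  "add_cat C = \<lparr>
     Obj = {xs. set xs \<subseteq> Obj C},
     Hom = (\<lambda>xs ys. {M \<in> carrier_mat (length ys) (length xs).
       \<forall>j<length ys. \<forall>i<length xs. M $$ (j, i) \<in> Hom C (xs ! i) (ys ! j)}),
     Idn = (\<lambda>xs. mat (length xs) (length xs)
       (\<lambda>(j, i). if j = i then Idn C (xs ! i) else Zero C (xs ! i) (xs ! j))),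
     Comp = (\<lambda>xs ys zs N M. mat (length zs) (length xs)
       (\<lambda>(k, i). hom_sum C (xs ! i) (zs ! k)
         (map (\<lambda>j. Comp C (xs ! i) (ys ! j) (zs ! k) (N $$ (k, j)) (M $$ (j, i)))
           [0..<length ys]))),
     Zero = (\<lambda>xs ys. mat (length ys) (length xs) (\<lambda>(j, i). Zero C (xs ! i) (ys ! j))),
     Plus = (\<lambda>xs ys M N. mat (length ys) (length xs)
       (\<lambda>(j, i). Plus C (xs ! i) (ys ! j) (M $$ (j, i)) (N $$ (j, i)))),
     Scale = (\<lambda>xs ys a M. mat (length ys) (length xs)
       (\<lambda>(j, i). Scale C (xs ! i) (ys ! j) a (M $$ (j, i))))\<rparr>"

definition PX ::
    "'r::comm_ring_1 \<Rightarrow> 'x set \<Rightarrow> ('x \<Rightarrow> 'x \<Rightarrow> 'x \<Rightarrow> nat) \<Rightarrow> ('r, 'x list, 'r mat) lincat" where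
  "PX t X c = add_cat (RX t X c)"

definition mf_cat :: "'r \<Rightarrow> ('r, 'o, 'm) lincat \<Rightarrow> ('r, 'o \<times> 'm, 'm) lincat" where
  "mf_cat t C = \<lparr>
     Obj = {(P, d). P \<in> Obj C \<and> d \<in> Hom C P P \<and> Comp C P P P d d = Scale C P P t (Idn C P)},
     Hom = (\<lambda>(P, d) (Q, e). {f \<in> Hom C P Q. Comp C P Q Q e f = Comp C P P Q f d}),
     Idn = (\<lambda>(P, d). Idn C P),
     Comp = (\<lambda>(P, _) (Q, _) (S, _). Comp C P Q S),
     Zero = (\<lambda>(P, _) (Q, _). Zero C P Q),
     Plus = (\<lambda>(P, _) (Q, _). Plus C P Q),
     Scale = (\<lambda>(P, _) (Q, _). Scale C P Q)\<rparr>"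

definition MF ::
    "'r::comm_ring_1 \<Rightarrow> 'x set \<Rightarrow> ('x \<Rightarrow> 'x \<Rightarrow> 'x \<Rightarrow> nat) \<Rightarrow> ('r, 'x list \<times> 'r mat, 'r mat) lincat" where
  "MF t X c = mf_cat t (PX t X c)"

definition MF_exact ::
    "'r::comm_ring_1 \<Rightarrow> 'x set \<Rightarrow> ('x \<Rightarrow> 'x \<Rightarrow> 'x \<Rightarrow> nat) \<Rightarrow> ('x list \<times> 'r mat, 'r mat) seq_class" where
  "MF_exact t X c A B D f g \<longleftrightarrow>
     A \<in> Obj (MF t X c) \<and> B \<in> Obj (MF t X c) \<and> D \<in> Obj (MF t X c) \<and>
     f \<in> Hom (MF t X c) A B \<and> g \<in> Hom (MF t X c) B D \<and>
     split_exact (PX t X c) (fst A) (fst B) (fst D) f g"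

text \<open>Concatenation of lists is the direct sum in \<^const>\<open>PX\<close>.\<close>

definition GP ::
    "'r::comm_ring_1 \<Rightarrow> 'x set \<Rightarrow> ('x \<Rightarrow> 'x \<Rightarrow> 'x \<Rightarrow> nat) \<Rightarrow> 'x list \<Rightarrow> 'x list \<times> 'r mat" where
  "GP t X c P =
     (P @ P,
      four_block_mat
        (Zero (PX t X c) P P) (Scale (PX t X c) P P t (Idn (PX t X c) P))
        (Idn (PX t X c) P)    (Zero (PX t X c) P P))"

end

theory Submission
  imports Defs
begin

text \<open>
  Composition in \<open>\<P>(X)\<close> is matrix multiplication twisted by powers of \<open>t\<close>. Rescaling the
  entry from \<open>P\<^sub>x\<close> to \<open>P\<^sub>y\<close> by \<open>t\<close> to the power \<open>c(x\<^sub>0xy)\<close>, for a fixed \<open>x\<^sub>0 \<in> X\<close>, removes the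
  twist by the cocycle identity, so \<open>\<P>(X)\<close> embeds into the ring of linear endomorphisms of
  \<open>\<nat> \<Rightarrow> R\<close> and computations with morphisms become computations in a noncommutative ring.

  A deflation is a morphism with a section in \<open>\<P>(X)\<close>, an inflation one with a retraction and a
  complement. Both projectivity and injectivity of \<open>(P, d)\<close> amount to \<open>dh + hd = 1\<close> for some
  \<open>h : P \<rightarrow> P\<close>: such an \<open>h\<close> turns a section into a lift, and conversely \<open>(P, d)\<close> is both a quotient
  and a subobject of \<open>GP\<close>.

  Given \<open>dh + hd = 1\<close>, write \<open>h = \<Sum> u\<^sub>i g\<^sub>i\<close> with \<open>u\<^sub>i\<close> and \<open>g\<^sub>i\<close> passing through some \<open>P\<^sub>x\<close>. The pair
  \<open>u\<^sub>i, g\<^sub>i\<close> corresponds to maps \<open>GP\<^sub>x \<rightarrow> (P, d) \<rightarrow> GP\<^sub>x\<close>. As the endomorphism ring \<open>R[\<surd>t]\<close> of \<open>GP\<^sub>x\<close> is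
  local, either their composite is invertible and \<open>GP\<^sub>x\<close> splits off, or the complementary
  endomorphism is invertible and the \<open>i\<close>-th term can be removed from the sum. Working with idempotents of
  \<open>(P, d)\<close> instead of direct summands avoids having to construct complements in \<open>\<P>(X)\<close>.
\<close>

section \<open>Factorizations over a category of ring elements\<close>

text \<open>The simplifier keeps products nested to the right, so a relation
  \<open>a * b = c\<close> needs this companion to fire inside a longer product.\<close>

lemma mult_left_eq: "(a::'a::semigroup_mult) * b = c \<Longrightarrow> a * (b * x) = c * x"
  by (simp flip: mult.assoc)

text \<open>A preadditive category whose arrows are elements of one ring. The sets \<open>H P Q\<close> need not be disjoint,
  and \<open>H P Q\<close> is empty if \<open>P\<close> or \<open>Q\<close> is not an object.\<close>

locale ring_category =
  fixes Ob :: "'o set" and H :: "'o \<Rightarrow> 'o \<Rightarrow> 'a::ring set" and one :: "'o \<Rightarrow> 'a"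
    and \<kappa> :: "'r::comm_ring_1 \<Rightarrow> 'a"
  assumes H_Ob: "f \<in> H P Q \<Longrightarrow> P \<in> Ob \<and> Q \<in> Ob"
    and one_H [simp]: "P \<in> Ob \<Longrightarrow> one P \<in> H P P"
    and zero_H [simp]: "\<lbrakk>P \<in> Ob; Q \<in> Ob\<rbrakk> \<Longrightarrow> 0 \<in> H P Q"
    and mult_H [intro]: "\<lbrakk>g \<in> H Q S; f \<in> H P Q\<rbrakk> \<Longrightarrow> g * f \<in> H P S"
    and add_H [intro]: "\<lbrakk>f \<in> H P Q; g \<in> H P Q\<rbrakk> \<Longrightarrow> f + g \<in> H P Q"
    and scale_H [intro]: "f \<in> H P Q \<Longrightarrow> \<kappa> r * f \<in> H P Q"
    and one_left: "f \<in> H P Q \<Longrightarrow> one Q * f = f"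
    and one_right: "f \<in> H P Q \<Longrightarrow> f * one P = f"
    and scale_central: "f * \<kappa> r = \<kappa> r * f"
    and scale_add: "\<kappa> (r + s) = \<kappa> r + \<kappa> s"
    and scale_mult: "\<kappa> (r * s) = \<kappa> r * \<kappa> s"
    and scale_one [simp]: "\<kappa> 1 * f = f"
begin

lemma scale_minus: "\<kappa> (- r) = - \<kappa> r"
proof -
  have "\<kappa> 0 = 0"
    using scale_add[of 0 0] by simp
  then show ?thesis
    using scale_add[of r "- r"] by (simp add: eq_neg_iff_add_eq_0 add.commute)
qed

lemma uminus_H [intro]: "f \<in> H P Q \<Longrightarrow> - f \<in> H P Q"
  using scale_H[of f P Q "-1"] by (simp add: scale_minus)

lemma diff_H [intro]: "\<lbrakk>f \<in> H P Q; g \<in> H P Q\<rbrakk> \<Longrightarrow> f - g \<in> H P Q"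
  using add_H[of f P Q "- g"] by auto

lemma one_left_assoc: "f \<in> H P Q \<Longrightarrow> one Q * (f * x) = f * x"
  by (simp add: one_left flip: mult.assoc)

lemma one_right_assoc: "f \<in> H P Q \<Longrightarrow> f * (one P * x) = f * x"
  by (metis one_right mult.assoc)

lemma scale_right: "f \<in> H P Q \<Longrightarrow> f * \<kappa> r = \<kappa> r * f"
  by (rule scale_central)

lemma scale_right_assoc: "f \<in> H P Q \<Longrightarrow> f * (\<kappa> r * x) = \<kappa> r * (f * x)"
  by (metis scale_central mult.assoc)

lemmas H_simps = one_left one_right one_left_assoc one_right_assoc scale_right scale_right_assoc

section \<open>Biproducts as systems of equations in the ring\<close>

definition biprod :: "'o \<Rightarrow> 'o \<Rightarrow> 'o \<Rightarrow> 'a \<Rightarrow> 'a \<Rightarrow> 'a \<Rightarrow> 'a \<Rightarrow> bool" where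
  "biprod P Q S i\<^sub>1 i\<^sub>2 p\<^sub>1 p\<^sub>2 \<longleftrightarrow>
     i\<^sub>1 \<in> H P S \<and> i\<^sub>2 \<in> H Q S \<and> p\<^sub>1 \<in> H S P \<and> p\<^sub>2 \<in> H S Q \<and>
     p\<^sub>1 * i\<^sub>1 = one P \<and> p\<^sub>2 * i\<^sub>2 = one Q \<and> p\<^sub>2 * i\<^sub>1 = 0 \<and> p\<^sub>1 * i\<^sub>2 = 0 \<and>
     i\<^sub>1 * p\<^sub>1 + i\<^sub>2 * p\<^sub>2 = one S"

text \<open>The completeness relation is turned into a rewrite rule that eliminates
  \<open>i\<^sub>2 * p\<^sub>2\<close>; proofs that need the other orientation swap the summands
  first.\<close>

lemma biprodD:
  assumes "biprod P Q S i\<^sub>1 i\<^sub>2 p\<^sub>1 p\<^sub>2"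
  shows "i\<^sub>1 \<in> H P S" "i\<^sub>2 \<in> H Q S" "p\<^sub>1 \<in> H S P" "p\<^sub>2 \<in> H S Q"
    "P \<in> Ob" "Q \<in> Ob" "S \<in> Ob"
    and "p\<^sub>1 * i\<^sub>1 = one P" "p\<^sub>2 * i\<^sub>2 = one Q" "p\<^sub>2 * i\<^sub>1 = 0" "p\<^sub>1 * i\<^sub>2 = 0"
    "i\<^sub>2 * p\<^sub>2 = one S - i\<^sub>1 * p\<^sub>1"
  using assms unfolding biprod_def by (auto dest: H_Ob simp: eq_diff_eq add.commute)

lemma biprod_rules:
  assumes "biprod P Q S i\<^sub>1 i\<^sub>2 p\<^sub>1 p\<^sub>2"
  shows "p\<^sub>1 * (i\<^sub>1 * x) = one P * x" "p\<^sub>2 * (i\<^sub>2 * x) = one Q * x"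
    "p\<^sub>2 * (i\<^sub>1 * x) = 0" "p\<^sub>1 * (i\<^sub>2 * x) = 0"
    "i\<^sub>2 * (p\<^sub>2 * x) = one S * x - i\<^sub>1 * (p\<^sub>1 * x)"
  using biprodD(8-12)[OF assms, THEN mult_left_eq] by (simp_all add: algebra_simps)

lemma biprod_swap: "biprod P Q S i\<^sub>1 i\<^sub>2 p\<^sub>1 p\<^sub>2 \<Longrightarrow> biprod Q P S i\<^sub>2 i\<^sub>1 p\<^sub>2 p\<^sub>1"
  by (auto simp: biprod_def add.commute)

text \<open>Reassociation of a threefold sum: a complement of \<open>j * f\<close> is pieced
  together from the complements of \<open>f\<close> and of \<open>j\<close>. This is what closes
  inflations under composition.\<close>

lemma biprod_assoc:
  assumes 1: "biprod P Q S f s r g" and 2: "biprod S Q' U j s' r' k"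
    and 3: "biprod Q Q' W a\<^sub>1 a\<^sub>2 b\<^sub>1 b\<^sub>2"
  shows "biprod P W U (j * f) (j * s * b\<^sub>1 + s' * b\<^sub>2) (r * r') (a\<^sub>1 * g * r' + a\<^sub>2 * k)"
proof -
  note b1 = biprodD[OF 1] and b2 = biprodD[OF 2] and b3 = biprodD[OF 3]
  show ?thesis
    unfolding biprod_def
    using b1(1-4) b2(1-4) b3(1-4)
    by (simp add: algebra_simps b1(5-) b2(5-) b3(5-) H_simps
        biprod_rules[OF 1] biprod_rules[OF 2] biprod_rules[OF 3])
      (auto intro!: add_H mult_H)
qed

end

text \<open>Objects stay abstract, with \<open>und\<close> and \<open>dif\<close> reading off the
  underlying object and the differential. Pairs of a list and a matrix can thus serve as objects
  while \<open>dif\<close> is the image of the matrix in the ring.\<close>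

locale factorizations = ring_category Ob H one \<kappa>
  for Ob :: "'o set" and H :: "'o \<Rightarrow> 'o \<Rightarrow> 'a::ring set" and one :: "'o \<Rightarrow> 'a"
    and \<kappa> :: "'r::comm_ring_1 \<Rightarrow> 'a" +
  fixes t :: 'r and MO :: "'b set" and und :: "'b \<Rightarrow> 'o" and dif :: "'b \<Rightarrow> 'a"
  assumes zero_Ob: "\<exists>Z\<in>Ob. one Z = 0"
    and biprod_exists: "\<lbrakk>P \<in> Ob; Q \<in> Ob\<rbrakk> \<Longrightarrow> \<exists>S i\<^sub>1 i\<^sub>2 p\<^sub>1 p\<^sub>2. biprod P Q S i\<^sub>1 i\<^sub>2 p\<^sub>1 p\<^sub>2"
    and und_Ob [simp]: "A \<in> MO \<Longrightarrow> und A \<in> Ob"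
    and dif_H: "A \<in> MO \<Longrightarrow> dif A \<in> H (und A) (und A)"
    and dif_dif: "A \<in> MO \<Longrightarrow> dif A * dif A = \<kappa> t * one (und A)"
    and MO_exists: "\<lbrakk>P \<in> Ob; \<delta> \<in> H P P; \<delta> * \<delta> = \<kappa> t * one P\<rbrakk>
      \<Longrightarrow> \<exists>A\<in>MO. und A = P \<and> dif A = \<delta>"
begin

section \<open>The category of factorizations\<close>

definition MH :: "'b \<Rightarrow> 'b \<Rightarrow> 'a set" where
  "MH A B = {f \<in> H (und A) (und B). dif B * f = f * dif A}"

definition mf :: "('b, 'a) precat" where
  "mf = \<lparr>Obj = MO, Hom = MH, Idn = (\<lambda>A. one (und A)), Comp = (\<lambda>_ _ _ g f. g * f),
    Zero = (\<lambda>_ _. 0), Plus = (\<lambda>_ _ f g. f + g)\<rparr>"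

lemma mf_simps [simp]:
  "Obj mf = MO" "Hom mf = MH" "Idn mf A = one (und A)" "Comp mf A B D g f = g * f"
  "Zero mf A B = 0" "Plus mf A B f g = f + g"
  by (simp_all add: mf_def)

definition mf_exact :: "'b \<Rightarrow> 'b \<Rightarrow> 'b \<Rightarrow> 'a \<Rightarrow> 'a \<Rightarrow> bool" where
  "mf_exact A B D f g \<longleftrightarrow> A \<in> MO \<and> B \<in> MO \<and> D \<in> MO \<and> f \<in> MH A B \<and> g \<in> MH B D \<and>
     (\<exists>s r. biprod (und A) (und D) (und B) f s r g)"

lemma MH_D:
  assumes "f \<in> MH A B"
  shows "f \<in> H (und A) (und B)" "dif B * f = f * dif A" "dif B * (f * x) = f * (dif A * x)"
    "one (und B) * f = f" "f * one (und A) = f" "one (und B) * (f * x) = f * x"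
    "f * (one (und A) * x) = f * x"
proof -
  show *: "f \<in> H (und A) (und B)" "dif B * f = f * dif A"
    using assms by (auto simp: MH_def)
  show "dif B * (f * x) = f * (dif A * x)"
    using *(2) by (simp flip: mult.assoc)
  show **: "one (und B) * f = f" "f * one (und A) = f"
    using * by (auto simp: one_left one_right)
  show "one (und B) * (f * x) = f * x" "f * (one (und A) * x) = f * x"
    using ** by (simp_all flip: mult.assoc)
qed

lemma dif_simps:
  assumes "A \<in> MO"
  shows "dif A * dif A = \<kappa> t * one (und A)" "dif A * (dif A * x) = \<kappa> t * (one (und A) * x)"
    "one (und A) * dif A = dif A" "one (und A) * (dif A * x) = dif A * x"
    "dif A * one (und A) = dif A" "dif A * (one (und A) * x) = dif A * x"
    "dif A * \<kappa> r = \<kappa> r * dif A" "dif A * (\<kappa> r * x) = \<kappa> r * (dif A * x)"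
  using dif_H[OF assms] mult_left_eq[OF dif_dif[OF assms]]
  by (simp_all add: H_simps dif_dif[OF assms] mult.assoc)

lemma MH_mult [intro]: "\<lbrakk>g \<in> MH B D; f \<in> MH A B\<rbrakk> \<Longrightarrow> g * f \<in> MH A D"
  by (auto simp: MH_def) (metis mult.assoc)

lemma MH_add [intro]: "\<lbrakk>f \<in> MH A B; g \<in> MH A B\<rbrakk> \<Longrightarrow> f + g \<in> MH A B"
  by (auto simp: MH_def algebra_simps)

lemma MH_uminus [intro]: "f \<in> MH A B \<Longrightarrow> - f \<in> MH A B"
  by (auto simp: MH_def)

lemma MH_one [simp]: "A \<in> MO \<Longrightarrow> one (und A) \<in> MH A A"
  by (auto simp: MH_def dif_simps)

lemma MH_zero [simp]: "\<lbrakk>A \<in> MO; B \<in> MO\<rbrakk> \<Longrightarrow> 0 \<in> MH A B"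
  by (auto simp: MH_def)

lemma preadditive_mf: "preadditive_category mf"
proof (unfold_locales, goal_cases)
  case (11 A B f)
  then show ?case
    by (auto intro!: bexI[of _ "- f"])
qed (auto simp: MH_D algebra_simps)

lemma zero_MO: "\<exists>Z\<in>MO. one (und Z) = 0"
proof -
  obtain Z where Z: "Z \<in> Ob" "one Z = 0"
    using zero_Ob by blast
  then have "0 \<in> H Z Z" "0 * 0 = \<kappa> t * one Z"
    by auto
  then show ?thesis
    using MO_exists Z by metis
qed

text \<open>The differential is triangular with diagonal \<open>dif A\<close>, \<open>dif B\<close>
  and corner \<open>h\<close>. The corner of its square is \<open>dif A * h + h * dif B\<close>,
  which the sign condition makes vanish. Taking \<open>h = 0\<close> gives direct sums; other
  \<open>h\<close> give the middle terms of pushouts and pullbacks.\<close>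

lemma MO_biprod:
  assumes "A \<in> MO" "B \<in> MO" "biprod (und A) (und B) S i\<^sub>1 i\<^sub>2 p\<^sub>1 p\<^sub>2" "h \<in> H (und B) (und A)"
    and "dif A * h = - (h * dif B)"
  shows "\<exists>M\<in>MO. und M = S \<and> dif M = i\<^sub>1 * dif A * p\<^sub>1 + i\<^sub>2 * dif B * p\<^sub>2 + i\<^sub>1 * h * p\<^sub>2"
proof (rule MO_exists)
  note b = biprodD[OF assms(3)]
  show "S \<in> Ob"
    using b by auto
  show "i\<^sub>1 * dif A * p\<^sub>1 + i\<^sub>2 * dif B * p\<^sub>2 + i\<^sub>1 * h * p\<^sub>2 \<in> H S S"
    using b assms(4) dif_H[OF assms(1)] dif_H[OF assms(2)] by (auto intro!: add_H mult_H)
  have "i\<^sub>1 * (dif A * (h * p\<^sub>2)) = - (i\<^sub>1 * (h * (dif B * p\<^sub>2)))"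
    using assms(5) by (metis mult.assoc mult_minus_left mult_minus_right)
  then show "(i\<^sub>1 * dif A * p\<^sub>1 + i\<^sub>2 * dif B * p\<^sub>2 + i\<^sub>1 * h * p\<^sub>2) *
      (i\<^sub>1 * dif A * p\<^sub>1 + i\<^sub>2 * dif B * p\<^sub>2 + i\<^sub>1 * h * p\<^sub>2) = \<kappa> t * one S"
    using assms(1,2) b(1-4) assms(4)
    by (simp add: algebra_simps b(5-) biprod_rules[OF assms(3)] H_simps dif_simps)
qed

text \<open>Relative to the splitting, \<open>dif B\<close> is triangular with corner
  \<open>r * dif B * s\<close>, and the equation is the corner of
  \<open>dif B * dif B = \<kappa> t * one (und B)\<close>. It supplies the sign condition of
  \<open>MO_biprod\<close>.\<close>

lemma mf_exactE:
  assumes "mf_exact A B D f g"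
  obtains s r where "biprod (und A) (und D) (und B) f s r g"
    and "dif A * (r * (dif B * s)) = - (r * (dif B * (s * dif D)))"
proof -
  obtain s r where b: "biprod (und A) (und D) (und B) f s r g"
    and A: "A \<in> MO" "B \<in> MO" "D \<in> MO" and f: "f \<in> MH A B" and g: "g \<in> MH B D"
    using assms by (auto simp: mf_exact_def)
  note b' = biprodD[OF b]
  have gd: "g * (dif B * x) = dif D * (g * x)" for x
    using MH_D(3)[OF g] by simp
  \<comment> \<open>The identity \<open>f * r + s * g\<close> is inserted between the two factors
    \<open>dif B\<close>; the right-hand side is t times \<open>r * s\<close>, hence 0.\<close>
  have "r * (dif B * ((f * r + s * g) * (dif B * s))) = r * (dif B * (dif B * s))"
    using b'(1-4) A by (simp add: b'(5-) algebra_simps dif_simps H_simps)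
  then have "dif A * (r * (dif B * s)) + r * (dif B * (s * dif D)) = 0"
    using b'(1-4) A
    by (simp add: b'(8-11) biprod_rules(1-4)[OF b] algebra_simps dif_simps H_simps
        MH_D(2,3)[OF f] gd)
  with b show ?thesis
    using that by (simp add: eq_neg_iff_add_eq_0)
qed

text \<open>Multiplication by \<open>l\<close> cancels \<open>f\<close> in
  \<open>f * (dif A * k) = f * (k * dif T)\<close>; \<open>l\<close> itself need not commute with
  the differentials.\<close>

lemma MH_left_factor:
  assumes "f \<in> MH A B" "k \<in> H (und T) (und A)" "f * k \<in> MH T B"
    and "l * f = one (und A)" "A \<in> MO" "T \<in> MO"
  shows "k \<in> MH T A"
proof -
  have "f * (dif A * k) = f * (k * dif T)"
    using assms(3) MH_D(3)[OF assms(1)] by (simp add: MH_def mult.assoc)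
  then have "l * (f * (dif A * k)) = l * (f * (k * dif T))"
    by simp
  then show ?thesis
    using assms(2,5) by (simp add: mult_left_eq[OF assms(4)] H_simps dif_simps MH_def)
qed

lemma MH_right_factor:
  assumes "g \<in> MH B D" "k \<in> H (und D) (und T)" "k * g \<in> MH B T"
    and "g * s = one (und D)" "D \<in> MO" "T \<in> MO"
  shows "k \<in> MH D T"
proof -
  have "dif T * k * g * s = k * dif D * g * s"
    using assms(3) MH_D(2)[OF assms(1)] by (simp add: MH_def flip: mult.assoc)
      (metis mult.assoc)
  then show ?thesis
    using assms(2,5) by (simp add: mult.assoc assms(4) H_simps dif_simps MH_def)
qed

section \<open>Kernels and cokernels, inflations and deflations\<close>

lemma kernel_cokernel_mf:
  assumes "mf_exact A B D f g"
  shows "kernel_cokernel_pair mf A B D f g"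
proof -
  obtain s r where b: "biprod (und A) (und D) (und B) f s r g"
    using assms by (rule mf_exactE)
  have A: "A \<in> MO" "B \<in> MO" "D \<in> MO" and f: "f \<in> MH A B" and g: "g \<in> MH B D"
    using assms by (auto simp: mf_exact_def)
  note b' = biprodD[OF b]
  have "\<exists>!k. k \<in> MH T A \<and> f * k = h" if T: "T \<in> MO" and h: "h \<in> MH T B" and "g * h = 0" for T h
  proof (rule ex1I)
    have "s * (g * h) = 0"
      using that by simp
    then have eq: "f * (r * h) = h"
      using MH_D(4)[OF h] by (simp add: biprod_rules[OF b])
    \<comment> \<open>The retraction \<open>r\<close> need not be a morphism of factorizations, but
      \<open>r * h\<close> is one because the split monomorphism \<open>f\<close> can be
      cancelled.\<close>
    have "r * h \<in> H (und T) (und A)"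
      using b' MH_D(1)[OF h] by blast
    then show "r * h \<in> MH T A \<and> f * (r * h) = h"
      using MH_left_factor[OF f _ _ b'(8) A(1) T] eq h by auto
    show "k = r * h" if "k \<in> MH T A \<and> f * k = h" for k
      using that MH_D(4)[of k T A] by (auto simp: biprod_rules[OF b])
  qed
  moreover have "\<exists>!k. k \<in> MH D T \<and> k * g = h"
    if T: "T \<in> MO" and h: "h \<in> MH B T" and hf: "h * f = 0" for T h
  proof (rule ex1I)
    have eq: "h * (s * g) = h"
      using MH_D(5)[OF h] by (simp add: b' algebra_simps mult_left_eq[OF hf])
    have "h * s \<in> H (und D) (und T)"
      using b' MH_D(1)[OF h] by blast
    then show "h * s \<in> MH D T \<and> h * s * g = h"
      using MH_right_factor[OF g _ _ b'(9) A(3) T] eq h by (auto simp: mult.assoc)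
    show "k = h * s" if "k \<in> MH D T \<and> k * g = h" for k
      using that MH_D(5)[of k D T] by (auto simp: b' mult.assoc)
  qed
  ultimately show ?thesis
    using A f g by (auto simp: kernel_cokernel_pair_def is_kernel_def is_cokernel_def b')
qed

text \<open>The complement \<open>Q\<close> receives the induced differential
  \<open>g * dif B * s\<close>. It squares to t because
  \<open>g * dif B * f = g * f * dif A = 0\<close>, so the part of the identity of \<open>B\<close>
  that passes through \<open>A\<close> contributes nothing.\<close>

lemma inflationI:
  assumes "A \<in> MO" "B \<in> MO" "f \<in> MH A B" and b: "biprod (und A) Q (und B) f s r g"
  shows "inflation mf_exact A B f"
proof -
  note b' = biprodD[OF b]
  have "g * dif B * s \<in> H Q Q"
    using b' dif_H[OF assms(2)] by blast
  moreover have "(g * dif B * s) * (g * dif B * s) = \<kappa> t * one Q"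
    using assms(1-3) b'(1-4)
    by (simp add: algebra_simps b'(5-) biprod_rules[OF b] H_simps dif_simps MH_D(2-3)[OF assms(3)])
  ultimately obtain D where D: "D \<in> MO" "und D = Q" "dif D = g * dif B * s"
    using MO_exists b' by meson
  have "dif D * g = g * dif B"
    using assms(1-3) b'(1-4)
    by (simp add: algebra_simps b'(5-) biprod_rules[OF b] H_simps dif_simps MH_D(2-3)[OF assms(3)] D)
  then have "mf_exact A B D f g"
    using D assms b' by (auto simp: mf_exact_def MH_def)
  then show ?thesis
    by (auto simp: inflation_def)
qed

lemma deflationI:
  assumes "B \<in> MO" "D \<in> MO" "g \<in> MH B D" and b: "biprod Q (und D) (und B) f s r g"
  shows "deflation mf_exact B D g"
proof -
  note b' = biprodD[OF b]
  \<comment> \<open>With the summands swapped, the rewriting eliminates \<open>f * r\<close> in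
    favour of \<open>s * g\<close>, and \<open>g\<close> is the map known to commute with the
    differentials.\<close>
  note sw = biprod_swap[OF b]
  note sw' = biprodD[OF sw]
  have g: "g * (dif B * x) = dif D * (g * x)" "g * dif B = dif D * g" for x
    using MH_D(2,3)[OF assms(3)] by auto
  have "r * dif B * f \<in> H Q Q"
    using b' dif_H[OF assms(1)] by blast
  moreover have "(r * dif B * f) * (r * dif B * f) = \<kappa> t * one Q"
    using assms(1-2) b'(1-4)
    by (simp add: algebra_simps sw'(5-) biprod_rules[OF sw] H_simps dif_simps g)
  ultimately obtain A where D: "A \<in> MO" "und A = Q" "dif A = r * dif B * f"
    using MO_exists b' by meson
  have "dif B * f = f * dif A"
    using assms(1-2) b'(1-4)
    by (simp add: algebra_simps sw'(5-) biprod_rules[OF sw] H_simps dif_simps g D)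
  then have "mf_exact A B D f g"
    using D assms b' by (auto simp: mf_exact_def MH_def)
  then show ?thesis
    by (auto simp: deflation_def)
qed

text \<open>Apart from being a morphism, an inflation only has to split in the underlying category:
  the differential on the complement comes for free.\<close>

lemma inflation_iff:
  "inflation mf_exact A B f \<longleftrightarrow> A \<in> MO \<and> B \<in> MO \<and> f \<in> MH A B \<and>
     (\<exists>Q s r g. biprod (und A) Q (und B) f s r g)"
proof
  assume "inflation mf_exact A B f"
  then show "A \<in> MO \<and> B \<in> MO \<and> f \<in> MH A B \<and> (\<exists>Q s r g. biprod (und A) Q (und B) f s r g)"
    unfolding inflation_def mf_exact_def by blast
qed (auto intro: inflationI)

lemma deflation_iff:
  "deflation mf_exact B D g \<longleftrightarrow> B \<in> MO \<and> D \<in> MO \<and> g \<in> MH B D \<and>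
     (\<exists>Q f s r. biprod Q (und D) (und B) f s r g)"
proof
  assume "deflation mf_exact B D g"
  then show "B \<in> MO \<and> D \<in> MO \<and> g \<in> MH B D \<and> (\<exists>Q f s r. biprod Q (und D) (und B) f s r g)"
    unfolding deflation_def mf_exact_def by blast
qed (auto intro: deflationI)

lemma inflation_mult:
  assumes "inflation mf_exact A B i" "inflation mf_exact B D j"
  shows "inflation mf_exact A D (j * i)"
proof -
  from assms obtain Q s r g Q' s' r' k where
    b: "biprod (und A) Q (und B) i s r g" "biprod (und B) Q' (und D) j s' r' k"
    and m: "A \<in> MO" "D \<in> MO" "i \<in> MH A B" "j \<in> MH B D"
    unfolding inflation_iff by blast
  moreover from b obtain W a\<^sub>1 a\<^sub>2 b\<^sub>1 b\<^sub>2 where c: "biprod Q Q' W a\<^sub>1 a\<^sub>2 b\<^sub>1 b\<^sub>2"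
    using biprod_exists biprodD by metis
  ultimately show ?thesis
    unfolding inflation_iff using biprod_assoc[OF b c] MH_mult[OF m(4,3)] by blast
qed

lemma deflation_mult:
  assumes "deflation mf_exact A B p" "deflation mf_exact B D q"
  shows "deflation mf_exact A D (q * p)"
proof -
  from assms obtain Q s r g Q' s' r' k where
    b: "biprod Q (und B) (und A) s g r p" "biprod Q' (und D) (und B) s' k r' q"
    and m: "A \<in> MO" "D \<in> MO" "p \<in> MH A B" "q \<in> MH B D"
    unfolding deflation_iff by metis
  moreover from b obtain W a\<^sub>1 a\<^sub>2 b\<^sub>1 b\<^sub>2 where c: "biprod Q' Q W a\<^sub>1 a\<^sub>2 b\<^sub>1 b\<^sub>2"
    using biprod_exists biprodD by metis
  \<comment> \<open>After swapping the summands, the sections \<open>g\<close> and \<open>k\<close>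
    play the part of the inclusions, and \<open>q * p\<close> is the retraction of their composite
    \<open>g * k\<close>.\<close>
  ultimately show ?thesis
    unfolding deflation_iff
    using biprod_swap[OF biprod_assoc[OF b(2,1)[THEN biprod_swap] c]] MH_mult[OF m(4,3)] by blast
qed

section \<open>Additivity and the axioms of an exact category\<close>

lemma biprod_zero:
  assumes "P \<in> Ob" "Z \<in> Ob" "one Z = 0"
  shows "biprod P Z P (one P) 0 (one P) 0"
  using assms by (auto simp: biprod_def one_left[OF one_H])

lemma additive_mf: "additive_category mf"
proof -
  obtain Z where Z: "Z \<in> MO" "one (und Z) = 0"
    using zero_MO by blast
  have "MH X Z = {0} \<and> MH Z X = {0}" if "X \<in> MO" for X
    using that Z MH_D(4,5) by (auto; force)
  then have "zero_object mf Z"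
    using Z by (simp add: zero_object_def)
  moreover have "\<exists>S i\<^sub>1 i\<^sub>2 p\<^sub>1 p\<^sub>2. is_biproduct mf A B S i\<^sub>1 i\<^sub>2 p\<^sub>1 p\<^sub>2" if A: "A \<in> MO" "B \<in> MO" for A B
  proof -
    obtain S i\<^sub>1 i\<^sub>2 p\<^sub>1 p\<^sub>2 where b: "biprod (und A) (und B) S i\<^sub>1 i\<^sub>2 p\<^sub>1 p\<^sub>2"
      using biprod_exists A by (meson und_Ob)
    then obtain M where M: "M \<in> MO" "und M = S"
        "dif M = i\<^sub>1 * dif A * p\<^sub>1 + i\<^sub>2 * dif B * p\<^sub>2"
      using MO_biprod[OF A b, of 0] A by auto
    note b' = biprodD[OF b]
    have "is_biproduct mf A B M i\<^sub>1 i\<^sub>2 p\<^sub>1 p\<^sub>2"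
      using A b'(1-4)
      by (simp add: is_biproduct_def M b'(5-) MH_def H_simps dif_simps biprod_rules[OF b] algebra_simps)
    then show ?thesis
      by blast
  qed
  ultimately show ?thesis
    using preadditive_mf by (auto simp: additive_category_def)
qed

lemma inflation_one: "A \<in> MO \<Longrightarrow> inflation mf_exact A A (one (und A))"
  and deflation_one: "A \<in> MO \<Longrightarrow> deflation mf_exact A A (one (und A))"
  using zero_Ob biprod_zero[of "und A"] biprod_swap[OF biprod_zero, of "und A"]
  by (auto simp: inflation_iff deflation_iff) blast+

lemma pushout_mf:
  assumes i: "inflation mf_exact A B i" and A': "A' \<in> MO" and f: "f \<in> MH A A'"
  shows "\<exists>B' i' f'. is_pushout mf A B A' B' i f i' f' \<and> inflation mf_exact A' B' i'"
proof -
  obtain D g where e: "mf_exact A B D i g"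
    using i by (auto simp: inflation_def)
  then have m: "A \<in> MO" "B \<in> MO" "D \<in> MO" "i \<in> MH A B" "g \<in> MH B D"
    by (auto simp: mf_exact_def)
  from e obtain s r where b: "biprod (und A) (und D) (und B) i s r g"
    and h: "dif A * (r * (dif B * s)) = - (r * (dif B * (s * dif D)))"
    by (rule mf_exactE)
  \<comment> \<open>The underlying object of the pushout is the sum of those of \<open>A'\<close>
    and \<open>D\<close>; the corner of its differential is \<open>f\<close> applied to the corner
    of \<open>dif B\<close>.\<close>
  obtain S i' s' r' g' where c: "biprod (und A') (und D) S i' s' r' g'"
    using biprod_exists m A' by (meson und_Ob)
  note b' = biprodD[OF b] and c' = biprodD[OF c]
  have "f * r * dif B * s \<in> H (und D) (und A')"
    using MH_D(1)[OF f] b' dif_H[OF m(2)] by blast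
  moreover have "dif A' * (f * r * dif B * s) = - (f * r * dif B * s * dif D)"
    using arg_cong[OF h, of "(*) f"] by (simp add: MH_D(3)[OF f] mult.assoc)
  ultimately obtain B' where B': "B' \<in> MO" "und B' = S"
    "dif B' = i' * dif A' * r' + s' * dif D * g' + i' * (f * r * dif B * s) * g'"
    using MO_biprod[OF A' m(3) c] by blast
  define f' where "f' = i' * f * r + s' * g"
  have f'H: "f' \<in> H (und B) (und B')"
    unfolding f'_def B' using b' c' MH_D(1)[OF f] by blast
  have i'M: "i' \<in> MH A' B'"
    using A' m b'(1-4) c'(1-4)
    by (simp add: MH_def B' algebra_simps c'(5-) biprod_rules[OF c] H_simps dif_simps)
  have sg: "s * (g * x) = one (und B) * x - i * (r * x)" for x
    by (rule biprod_rules[OF b])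
  have rd: "r * (dif B * (i * x)) = dif A * (one (und A) * x)"
    "r * (dif B * i) = dif A" for x
    using m by (simp_all add: MH_D(2,3)[OF m(4)] biprod_rules[OF b] b' dif_simps)
  have gd: "dif D * g = g * dif B"
    using MH_D(2)[OF m(5)] by simp
  have f'M: "f' \<in> MH B B'"
    using f'H A' m b'(1-4) c'(1-4) MH_D(1)[OF f]
    by (simp add: MH_def B' f'_def algebra_simps c'(5-) b'(5-) biprod_rules[OF c] biprod_rules[OF b]
        H_simps dif_simps rd gd MH_D(2,3)[OF f])
  have comm: "f' * i = i' * f"
    using b'(1-4) c'(1-4) MH_D(1)[OF f]
    by (simp add: f'_def algebra_simps b'(5-) H_simps)
  have "\<exists>!k. k \<in> MH B' T \<and> k * f' = u \<and> k * i' = v"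
    if T: "T \<in> MO" and u: "u \<in> MH B T" and v: "v \<in> MH A' T" and eq: "u * i = v * f" for T u v
  proof (rule ex1I)
    let ?k = "v * r' + u * s * g'"
    have uv: "u * (i * x) = v * (f * x)" for x
      using eq by (simp flip: mult.assoc)
    have kH: "?k \<in> H (und B') (und T)"
      using c' b' MH_D(1)[OF u] MH_D(1)[OF v] unfolding B' by blast
    have k1: "?k * f' = u"
      using b'(1-4) c'(1-4) MH_D(1)[OF f] MH_D(1)[OF u]
      by (simp add: f'_def algebra_simps b'(5-) c'(5-) H_simps biprod_rules[OF c] biprod_rules[OF b] uv)
    have k2: "?k * i' = v"
      using b'(1-4) c'(1-4) MH_D(1)[OF v]
      by (simp add: algebra_simps b'(5-) c'(5-) H_simps)
    \<comment> \<open>The maps \<open>f'\<close> and \<open>i'\<close> are jointly epic. This gives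
      uniqueness, and it also reduces the commutation of \<open>?k\<close> with the differentials to
      that of \<open>u\<close> and \<open>v\<close>.\<close>
    have ext: "x = y" if "x \<in> H (und B') (und T)" "y \<in> H (und B') (und T)" "x * f' = y * f'" "x * i' = y * i'"
      for x y
    proof -
      have "z = (z * i') * r' + (z * f') * s * g'" if "z \<in> H (und B') (und T)" for z
        using b'(1-4) c'(1-4) that MH_D(1)[OF f]
        by (simp add: f'_def B' algebra_simps b'(5-) c'(5-) H_simps biprod_rules[OF b])
      then show ?thesis
        using that by metis
    qed
    have "dif T * ?k = ?k * dif B'"
    proof (rule ext)
      show "dif T * ?k * f' = ?k * dif B' * f'"
        using MH_D(2)[OF f'M] MH_D(2)[OF u] k1 by (metis mult.assoc)
      show "dif T * ?k * i' = ?k * dif B' * i'"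
        using MH_D(2)[OF i'M] MH_D(2)[OF v] k2 by (metis mult.assoc)
    qed (use kH dif_H[OF T] dif_H[OF B'(1)] in blast)+
    with kH k1 k2 show "?k \<in> MH B' T \<and> ?k * f' = u \<and> ?k * i' = v"
      by (simp add: MH_def)
    show "k = ?k" if "k \<in> MH B' T \<and> k * f' = u \<and> k * i' = v" for k
      using that ext[OF _ kH] k1 k2 by (auto simp: MH_def)
  qed
  then have "is_pushout mf A B A' B' i f i' f'"
    using B' i'M f'M comm by (simp add: is_pushout_def)
  moreover have "inflation mf_exact A' B' i'"
    using inflationI[OF A' B'(1) i'M] c B'(2) by blast
  ultimately show ?thesis
    by blast
qed

lemma pullback_mf:
  assumes p: "deflation mf_exact B D p" and D': "D' \<in> MO" and v: "v \<in> MH D' D"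
  shows "\<exists>B' p' f'. is_pullback mf B D B' D' p v p' f' \<and> deflation mf_exact B' D' p'"
proof -
  obtain A f where e: "mf_exact A B D f p"
    using p by (auto simp: deflation_def)
  then have m: "A \<in> MO" "B \<in> MO" "D \<in> MO" "f \<in> MH A B" "p \<in> MH B D"
    by (auto simp: mf_exact_def)
  from e obtain s r where b: "biprod (und A) (und D) (und B) f s r p"
    and h: "dif A * (r * (dif B * s)) = - (r * (dif B * (s * dif D)))"
    by (rule mf_exactE)
  \<comment> \<open>Dually to the pushout, the pullback is carried by the sum of the underlying
    objects of \<open>A\<close> and \<open>D'\<close>, and its corner is that of
    \<open>dif B\<close> followed on the right by \<open>v\<close>.\<close>
  obtain S i\<^sub>1 i\<^sub>2 p\<^sub>1 p\<^sub>2 where c: "biprod (und A) (und D') S i\<^sub>1 i\<^sub>2 p\<^sub>1 p\<^sub>2"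
    using biprod_exists m D' by (meson und_Ob)
  note b' = biprodD[OF b] and c' = biprodD[OF c]
  have "r * dif B * s * v \<in> H (und D') (und A)"
    using MH_D(1)[OF v] b' dif_H[OF m(2)] by blast
  moreover have "dif A * (r * dif B * s * v) = - (r * dif B * s * v * dif D')"
    using arg_cong[OF h, of "\<lambda>x. x * v"] by (simp add: MH_D(2)[OF v] mult.assoc)
  ultimately obtain B' where B': "B' \<in> MO" "und B' = S"
    "dif B' = i\<^sub>1 * dif A * p\<^sub>1 + i\<^sub>2 * dif D' * p\<^sub>2 + i\<^sub>1 * (r * dif B * s * v) * p\<^sub>2"
    using MO_biprod[OF m(1) D' c] by blast
  define f' where "f' = f * p\<^sub>1 + s * v * p\<^sub>2"
  have f'H: "f' \<in> H (und B') (und B)"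
    unfolding f'_def B' using b' c' MH_D(1)[OF v] by blast
  have p'M: "p\<^sub>2 \<in> MH B' D'"
    using D' m b'(1-4) c'(1-4)
    by (simp add: MH_def B' algebra_simps c'(8-11) biprod_rules(1-4)[OF c] H_simps dif_simps)
  have fr: "f * (r * x) = one (und B) * x - s * (p * x)" for x
    by (rule biprod_rules[OF biprod_swap[OF b]])
  have pd: "p * (dif B * x) = dif D * (p * x)" for x
    using MH_D(3)[OF m(5)] by simp
  have f'M: "f' \<in> MH B' B"
    using f'H D' m b'(1-4) c'(1-4) MH_D(1)[OF v]
    by (simp add: MH_def B' f'_def algebra_simps c'(8-11) b'(8-11) biprod_rules(1-4)[OF c]
        biprod_rules(1-4)[OF b] fr H_simps dif_simps pd MH_D(2,3)[OF v] MH_D(2,3)[OF m(4)])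
  have comm: "p * f' = v * p\<^sub>2"
    using b'(1-4) c'(1-4) MH_D(1)[OF v]
    by (simp add: f'_def algebra_simps biprod_rules[OF b] H_simps)
  have "\<exists>!k. k \<in> MH T B' \<and> f' * k = u \<and> p\<^sub>2 * k = w"
    if T: "T \<in> MO" and u: "u \<in> MH T B" and w: "w \<in> MH T D'" and eq: "p * u = v * w" for T u w
  proof (rule ex1I)
    let ?k = "i\<^sub>1 * r * u + i\<^sub>2 * w"
    have kH: "?k \<in> H (und T) (und B')"
      using c' b' MH_D(1)[OF u] MH_D(1)[OF w] unfolding B' by blast
    have k1: "f' * ?k = u"
      using b'(1-4) c'(1-4) MH_D(1)[OF w] MH_D(1)[OF u]
      by (simp add: f'_def algebra_simps H_simps biprod_rules(1-4)[OF c] biprod_rules(1-4)[OF b] eq fr)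
    have k2: "p\<^sub>2 * ?k = w"
      using b'(1-4) c'(1-4) MH_D(1)[OF w]
      by (simp add: algebra_simps H_simps biprod_rules[OF c])
    have ext: "x = y" if "x \<in> H (und T) (und B')" "y \<in> H (und T) (und B')" "f' * x = f' * y" "p\<^sub>2 * x = p\<^sub>2 * y"
      for x y
    proof -
      have "z = i\<^sub>1 * (r * (f' * z)) + i\<^sub>2 * (p\<^sub>2 * z)" if "z \<in> H (und T) (und B')" for z
        using b'(1-4) c'(1-4) that MH_D(1)[OF v]
        by (simp add: f'_def B' algebra_simps H_simps biprod_rules(1-4)[OF b]
          biprod_rules[OF c])
      then show ?thesis
        using that by metis
    qed
    have "dif B' * ?k = ?k * dif T"
    proof (rule ext)
      show "f' * (dif B' * ?k) = f' * (?k * dif T)"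
        using MH_D(2)[OF f'M] MH_D(2)[OF u] k1 by (metis mult.assoc)
      show "p\<^sub>2 * (dif B' * ?k) = p\<^sub>2 * (?k * dif T)"
        using MH_D(2)[OF p'M] MH_D(2)[OF w] k2 by (metis mult.assoc)
    qed (use kH dif_H[OF T] dif_H[OF B'(1)] in blast)+
    with kH k1 k2 show "?k \<in> MH T B' \<and> f' * ?k = u \<and> p\<^sub>2 * ?k = w"
      by (simp add: MH_def)
    show "k = ?k" if "k \<in> MH T B' \<and> f' * k = u \<and> p\<^sub>2 * k = w" for k
      using that ext[OF _ kH] k1 k2 by (auto simp: MH_def)
  qed
  then have "is_pullback mf B D B' D' p v p\<^sub>2 f'"
    using B' p'M f'M comm by (simp add: is_pullback_def)
  moreover have "deflation mf_exact B' D' p\<^sub>2"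
    using deflationI[OF B'(1) D' p'M] c B'(2) by blast
  ultimately show ?thesis
    by blast
qed

lemma mf_exact_iso:
  assumes e: "mf_exact A B D f g"
    and isos: "is_iso mf A A' a" "is_iso mf B B' b" "is_iso mf D D' d"
    and f': "f' \<in> MH A' B'" and g': "g' \<in> MH B' D'" and eq: "b * f = f' * a" "d * g = g' * b"
  shows "mf_exact A' B' D' f' g'"
proof -
  obtain s r where c: "biprod (und A) (und D) (und B) f s r g"
    using e by (rule mf_exactE)
  from isos obtain a' b' d' where m: "A' \<in> MO" "B' \<in> MO" "D' \<in> MO"
    "a \<in> MH A A'" "b \<in> MH B B'" "d \<in> MH D D'"
    "a' \<in> MH A' A" "b' \<in> MH B' B" "d' \<in> MH D' D"
    and i: "a' * a = one (und A)" "a * a' = one (und A')" "b' * b = one (und B)"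
    "b * b' = one (und B')" "d' * d = one (und D)" "d * d' = one (und D')"
    by (auto simp: is_iso_def)
  note mH = m(4-9)[THEN MH_D(1)] and c' = biprodD[OF c]
  have fe: "f' = b * (f * a')"
    using i(2) eq(1) MH_D(5)[OF f'] by (metis mult.assoc)
  have ge: "g' = d * (g * b')"
    using i(4) eq(2) MH_D(5)[OF g'] by (metis mult.assoc)
  \<comment> \<open>The splitting is carried along the isomorphisms: section and retraction are
    conjugated just as \<open>f\<close> and \<open>g\<close> are.\<close>
  have "biprod (und A') (und D') (und B') f' (b * (s * d')) (a * (r * b')) g'"
    unfolding biprod_def
  proof (intro conjI)
    show "f' * (a * (r * b')) + b * (s * d') * g' = one (und B')"
      using c'(1-4) mH
      by (simp add: fe ge algebra_simps i i[THEN mult_left_eq] H_simps c'(5-) biprod_rules[OF c])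
  qed (use MH_D(1)[OF f'] MH_D(1)[OF g'] c'(1-4) mH in
      \<open>auto simp: fe ge mult.assoc i i[THEN mult_left_eq] H_simps c'(5-) biprod_rules[OF c]\<close>)
  then show ?thesis
    using m f' g' by (auto simp: mf_exact_def)
qed

lemma exact_mf: "exact_category mf mf_exact"
proof (unfold_locales, goal_cases)
  case (3 A B D i p A' a B' b D' d i' p')
  then show ?case
    using mf_exact_iso by simp
qed (use additive_mf kernel_cokernel_mf inflation_one deflation_one inflation_mult deflation_mult
    pushout_mf pullback_mf in simp_all)

section \<open>Contractible objects, projectives and injectives\<close>

definition contractible :: "'b \<Rightarrow> bool" where
  "contractible A \<longleftrightarrow> A \<in> MO \<and>
     (\<exists>h\<in>H (und A) (und A). dif A * h + h * dif A = one (und A))"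

text \<open>An abstract form of \<open>GP\<close>: the differential has the rows (0, t) and (1, 0)
  relative to an arbitrary biproduct of \<open>P\<close> with itself, so no concrete model of the
  sum is fixed.\<close>

definition is_double :: "'o \<Rightarrow> 'b \<Rightarrow> 'a \<Rightarrow> 'a \<Rightarrow> 'a \<Rightarrow> 'a \<Rightarrow> bool" where
  "is_double P G i\<^sub>1 i\<^sub>2 p\<^sub>1 p\<^sub>2 \<longleftrightarrow> G \<in> MO \<and> biprod P P (und G) i\<^sub>1 i\<^sub>2 p\<^sub>1 p\<^sub>2 \<and>
     dif G = i\<^sub>2 * p\<^sub>1 + \<kappa> t * (i\<^sub>1 * p\<^sub>2)"

lemma double_square:
  assumes b: "biprod P P S i\<^sub>1 i\<^sub>2 p\<^sub>1 p\<^sub>2"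
  shows "(i\<^sub>2 * p\<^sub>1 + \<kappa> t * (i\<^sub>1 * p\<^sub>2)) * (i\<^sub>2 * p\<^sub>1 + \<kappa> t * (i\<^sub>1 * p\<^sub>2)) = \<kappa> t * one S"
  using biprodD(1-4)[OF b] by (simp add: biprodD(5-)[OF b] biprod_rules[OF b] H_simps algebra_simps)

lemma double_exists:
  assumes "P \<in> Ob"
  obtains G i\<^sub>1 i\<^sub>2 p\<^sub>1 p\<^sub>2 where "is_double P G i\<^sub>1 i\<^sub>2 p\<^sub>1 p\<^sub>2"
proof -
  obtain S i\<^sub>1 i\<^sub>2 p\<^sub>1 p\<^sub>2 where b: "biprod P P S i\<^sub>1 i\<^sub>2 p\<^sub>1 p\<^sub>2"
    using assms biprod_exists by blast
  note b' = biprodD[OF b]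
  have "i\<^sub>2 * p\<^sub>1 + \<kappa> t * (i\<^sub>1 * p\<^sub>2) \<in> H S S"
    using b' by blast
  then show ?thesis
    using MO_exists[OF b'(7) _ double_square[OF b]] b that unfolding is_double_def by blast
qed

lemma contractible_double:
  assumes "is_double P G i\<^sub>1 i\<^sub>2 p\<^sub>1 p\<^sub>2"
  shows "contractible G"
proof -
  have b: "biprod P P (und G) i\<^sub>1 i\<^sub>2 p\<^sub>1 p\<^sub>2" and G: "G \<in> MO" "dif G = i\<^sub>2 * p\<^sub>1 + \<kappa> t * (i\<^sub>1 * p\<^sub>2)"
    using assms by (auto simp: is_double_def)
  note b' = biprodD[OF b]
  \<comment> \<open>The homotopy is the matrix unit with 1 in the upper right corner; multiplying it
    by \<open>dif G\<close> on the left and on the right yields the two diagonal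
    projections.\<close>
  have "dif G * (i\<^sub>1 * p\<^sub>2) + (i\<^sub>1 * p\<^sub>2) * dif G = one (und G)"
    using b'(1-4) by (simp add: G b'(5-) biprod_rules[OF b] H_simps algebra_simps)
  then show ?thesis
    using G b' unfolding contractible_def by blast
qed

lemma projective_contractible:
  assumes "contractible A"
  shows "projective_object mf mf_exact A"
proof -
  obtain h where A: "A \<in> MO" and h: "h \<in> H (und A) (und A)" and eq: "dif A * h + h * dif A = one (und A)"
    using assms by (auto simp: contractible_def)
  have "\<exists>k\<in>MH A B. p * k = f" if e: "deflation mf_exact B D p" and f: "f \<in> MH A D" for B D p f
  proof -
    obtain Q i s r where m: "B \<in> MO" "D \<in> MO" "p \<in> MH B D" and b: "biprod Q (und D) (und B) i s r p"
      using e by (auto simp: deflation_iff)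
    note b' = biprodD[OF b]
    \<comment> \<open>The map \<open>s * (f * h)\<close> lives on underlying objects only. For any
      such \<open>x\<close> the sum \<open>dif B * x + x * dif A\<close> commutes with the
      differentials, since both square to t, and for this \<open>x\<close> composition with
      \<open>p\<close> gives \<open>f * (dif A * h + h * dif A)\<close>.\<close>
    let ?k = "dif B * (s * (f * h)) + s * (f * (h * dif A))"
    have "?k \<in> H (und A) (und B)"
      using h b' MH_D(1)[OF f] dif_H[OF m(1)] dif_H[OF A] by blast
    then have "?k \<in> MH A B"
      using h b'(1-4) MH_D(1)[OF f] A m(1)
      by (simp add: MH_def algebra_simps H_simps dif_simps)
    moreover have pd: "p * (dif B * x) = dif D * (p * x)" for x
      using MH_D(3)[OF m(3)] by simp
    have "p * ?k = f * (dif A * h + h * dif A)"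
      using h b'(1-4) MH_D(1)[OF f] A m(1)
      by (simp add: algebra_simps pd biprod_rules[OF b] H_simps MH_D(3)[OF f])
    then have "p * ?k = f"
      using eq MH_D(5)[OF f] by simp
    ultimately show ?thesis
      by blast
  qed
  then show ?thesis
    using A by (simp add: projective_object_def)
qed

lemma injective_contractible:
  assumes "contractible A"
  shows "injective_object mf mf_exact A"
proof -
  obtain h where A: "A \<in> MO" and h: "h \<in> H (und A) (und A)" and eq: "dif A * h + h * dif A = one (und A)"
    using assms by (auto simp: contractible_def)
  have "\<exists>k\<in>MH D A. k * i = f" if e: "inflation mf_exact B D i" and f: "f \<in> MH B A" for B D i f
  proof -
    obtain Q p s r where m: "B \<in> MO" "D \<in> MO" "i \<in> MH B D" and b: "biprod (und B) Q (und D) i s r p"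
      using e by (auto simp: inflation_iff)
    note b' = biprodD[OF b]
    \<comment> \<open>The same symmetrization, now applied to the underlying map
      \<open>h * (f * r)\<close>.\<close>
    let ?k = "dif A * (h * (f * r)) + h * (f * (r * dif D))"
    have "?k \<in> H (und D) (und A)"
      using h b' MH_D(1)[OF f] dif_H[OF m(2)] dif_H[OF A] by blast
    then have "?k \<in> MH D A"
      using h b'(1-4) MH_D(1)[OF f] A m(1,2)
      by (simp add: MH_def algebra_simps H_simps dif_simps)
    moreover
    have "?k * i = (dif A * h + h * dif A) * f"
      using h b'(1-4) MH_D(1)[OF f] A m(1)
      by (simp add: algebra_simps biprod_rules[OF b] b' MH_D(2,3)[OF m(3)] H_simps MH_D(2,3)[OF f])
    then have "?k * i = f"
      using eq MH_D(4)[OF f] by simp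
    ultimately show ?thesis
      by blast
  qed
  then show ?thesis
    using A by (simp add: injective_object_def)
qed

text \<open>The map is the row (1, d). It is split by the first inclusion, and its kernel is the
  column (-d, 1).\<close>

lemma deflation_double:
  assumes "A \<in> MO" "is_double (und A) G i\<^sub>1 i\<^sub>2 p\<^sub>1 p\<^sub>2"
  shows "deflation mf_exact G A (p\<^sub>1 + dif A * p\<^sub>2)"
proof -
  have b: "biprod (und A) (und A) (und G) i\<^sub>1 i\<^sub>2 p\<^sub>1 p\<^sub>2"
    and G: "G \<in> MO" "dif G = i\<^sub>2 * p\<^sub>1 + \<kappa> t * (i\<^sub>1 * p\<^sub>2)"
    using assms by (auto simp: is_double_def)
  note b' = biprodD[OF b]
  have H: "p\<^sub>1 + dif A * p\<^sub>2 \<in> H (und G) (und A)" "i\<^sub>2 - i\<^sub>1 * dif A \<in> H (und A) (und G)"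
    using b' dif_H[OF assms(1)] by blast+
  then have "p\<^sub>1 + dif A * p\<^sub>2 \<in> MH G A"
    using b'(1-4) assms(1)
    by (simp add: MH_def G(2) b'(5-) algebra_simps H_simps dif_simps biprod_rules[OF b])
  moreover have "biprod (und A) (und A) (und G) (i\<^sub>2 - i\<^sub>1 * dif A) i\<^sub>1 p\<^sub>2 (p\<^sub>1 + dif A * p\<^sub>2)"
    using b'(1-4) assms(1) H
    by (simp add: biprod_def b'(5-) algebra_simps H_simps dif_simps biprod_rules[OF b])
  ultimately show ?thesis
    using assms(1) G(1) by (auto simp: deflation_iff)
qed

text \<open>The map is the column (d, 1). The second projection retracts it, and its cokernel is the
  row (1, -d).\<close>

lemma inflation_double:
  assumes "A \<in> MO" "is_double (und A) G i\<^sub>1 i\<^sub>2 p\<^sub>1 p\<^sub>2"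
  shows "inflation mf_exact A G (i\<^sub>1 * dif A + i\<^sub>2)"
proof -
  have b: "biprod (und A) (und A) (und G) i\<^sub>1 i\<^sub>2 p\<^sub>1 p\<^sub>2"
    and G: "G \<in> MO" "dif G = i\<^sub>2 * p\<^sub>1 + \<kappa> t * (i\<^sub>1 * p\<^sub>2)"
    using assms by (auto simp: is_double_def)
  note b' = biprodD[OF b]
  have H: "i\<^sub>1 * dif A + i\<^sub>2 \<in> H (und A) (und G)" "p\<^sub>1 - dif A * p\<^sub>2 \<in> H (und G) (und A)"
    using b' dif_H[OF assms(1)] by blast+
  then have "i\<^sub>1 * dif A + i\<^sub>2 \<in> MH A G"
    using b'(1-4) assms(1)
    by (simp add: MH_def G(2) b'(5-) algebra_simps H_simps dif_simps biprod_rules[OF b])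
  moreover have "biprod (und A) (und A) (und G) (i\<^sub>1 * dif A + i\<^sub>2) i\<^sub>1 p\<^sub>2 (p\<^sub>1 - dif A * p\<^sub>2)"
    using b'(1-4) assms(1) H
    by (simp add: biprod_def b'(5-) algebra_simps H_simps dif_simps biprod_rules[OF b])
  ultimately show ?thesis
    using assms(1) G(1) by (auto simp: inflation_iff)
qed

lemma contractible_projective:
  assumes "projective_object mf mf_exact A"
  shows "contractible A"
proof -
  have A: "A \<in> MO"
    using assms by (simp add: projective_object_def)
  obtain G i\<^sub>1 i\<^sub>2 p\<^sub>1 p\<^sub>2 where d: "is_double (und A) G i\<^sub>1 i\<^sub>2 p\<^sub>1 p\<^sub>2"
    by (rule double_exists[OF und_Ob[OF A]])
  then have b: "biprod (und A) (und A) (und G) i\<^sub>1 i\<^sub>2 p\<^sub>1 p\<^sub>2"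
    and G: "dif G = i\<^sub>2 * p\<^sub>1 + \<kappa> t * (i\<^sub>1 * p\<^sub>2)"
    by (auto simp: is_double_def)
  note b' = biprodD[OF b]
  obtain k where k: "k \<in> MH A G" "(p\<^sub>1 + dif A * p\<^sub>2) * k = one (und A)"
    using assms deflation_double[OF A d] MH_one[OF A] unfolding projective_object_def mf_simps by blast
  \<comment> \<open>The second component of \<open>dif G * k = k * dif A\<close> reads
    \<open>p\<^sub>1 * k = p\<^sub>2 * k * dif A\<close>. Substituted into the section equation for
    \<open>k\<close>, it shows that \<open>p\<^sub>2 * k\<close> is a contracting homotopy.\<close>
  have "p\<^sub>2 * (dif G * k) = p\<^sub>2 * (k * dif A)"
    using MH_D(2)[OF k(1)] by simp
  then have "p\<^sub>1 * k = p\<^sub>2 * (k * dif A)"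
    using b'(1-4) MH_D(1)[OF k(1)]
    by (simp add: G b'(5-11) algebra_simps H_simps biprod_rules(1-4)[OF b])
  then have "dif A * (p\<^sub>2 * k) + (p\<^sub>2 * k) * dif A = one (und A)"
    using k(2) by (simp add: algebra_simps)
  moreover have "p\<^sub>2 * k \<in> H (und A) (und A)"
    using b' MH_D(1)[OF k(1)] by blast
  ultimately show ?thesis
    using A unfolding contractible_def by blast
qed

lemma contractible_injective:
  assumes "injective_object mf mf_exact A"
  shows "contractible A"
proof -
  have A: "A \<in> MO"
    using assms by (simp add: injective_object_def)
  obtain G i\<^sub>1 i\<^sub>2 p\<^sub>1 p\<^sub>2 where d: "is_double (und A) G i\<^sub>1 i\<^sub>2 p\<^sub>1 p\<^sub>2"
    by (rule double_exists[OF und_Ob[OF A]])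
  then have b: "biprod (und A) (und A) (und G) i\<^sub>1 i\<^sub>2 p\<^sub>1 p\<^sub>2"
    and G: "dif G = i\<^sub>2 * p\<^sub>1 + \<kappa> t * (i\<^sub>1 * p\<^sub>2)"
    by (auto simp: is_double_def)
  note b' = biprodD[OF b]
  obtain k where k: "k \<in> MH G A" "k * (i\<^sub>1 * dif A + i\<^sub>2) = one (und A)"
    using assms inflation_double[OF A d] MH_one[OF A] unfolding injective_object_def mf_simps by blast
  \<comment> \<open>Restricting \<open>dif A * k = k * dif G\<close> to the first summand gives
    \<open>dif A * k * i\<^sub>1 = k * i\<^sub>2\<close>, so the retraction equation makes
    \<open>k * i\<^sub>1\<close> a contracting homotopy.\<close>
  have "dif A * k * i\<^sub>1 = k * dif G * i\<^sub>1"
    using MH_D(2)[OF k(1)] by simp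
  then have "dif A * (k * i\<^sub>1) = k * i\<^sub>2"
    using b'(1-4) MH_D(1)[OF k(1)]
    by (simp add: G b'(5-11) algebra_simps H_simps biprod_rules(1-4)[OF b])
  then have "dif A * (k * i\<^sub>1) + (k * i\<^sub>1) * dif A = one (und A)"
    using k(2) by (simp add: algebra_simps)
  moreover have "k * i\<^sub>1 \<in> H (und A) (und A)"
    using b' MH_D(1)[OF k(1)] by blast
  ultimately show ?thesis
    using A unfolding contractible_def by blast
qed

lemma projective_iff_contractible: "projective_object mf mf_exact A \<longleftrightarrow> contractible A"
  and injective_iff_contractible: "injective_object mf mf_exact A \<longleftrightarrow> contractible A"
  using projective_contractible contractible_projective injective_contractible contractible_injective
  by blast+

lemma frobenius_mf: "frobenius_category mf mf_exact"
proof -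
  interpret exact_category mf mf_exact
    by (rule exact_mf)
  show ?thesis
  proof (unfold_locales, goal_cases)
    case (1 A)
    then have A: "A \<in> MO"
      by simp
    obtain G i\<^sub>1 i\<^sub>2 p\<^sub>1 p\<^sub>2 where d: "is_double (und A) G i\<^sub>1 i\<^sub>2 p\<^sub>1 p\<^sub>2"
      by (rule double_exists[OF und_Ob[OF A]])
    show ?case
      using deflation_double[OF A d] projective_contractible[OF contractible_double[OF d]] by blast
  next
    case (2 A)
    then have A: "A \<in> MO"
      by simp
    obtain G i\<^sub>1 i\<^sub>2 p\<^sub>1 p\<^sub>2 where d: "is_double (und A) G i\<^sub>1 i\<^sub>2 p\<^sub>1 p\<^sub>2"
      by (rule double_exists[OF und_Ob[OF A]])
    show ?case
      using inflation_double[OF A d] injective_contractible[OF contractible_double[OF d]] by blast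
  qed (simp add: projective_iff_contractible injective_iff_contractible)
qed

lemma contractible_iso:
  assumes "isomorphic mf A B" "contractible B"
  shows "contractible A"
proof -
  obtain f g h where m: "A \<in> MO" "B \<in> MO" "f \<in> MH A B" "g \<in> MH B A" "h \<in> H (und B) (und B)"
    and i: "g * f = one (und A)" and eq: "dif B * h + h * dif B = one (und B)"
    using assms by (auto simp: isomorphic_def is_iso_def contractible_def)
  have "dif A * (g * (h * f)) + g * (h * f) * dif A = g * (dif B * h + h * dif B) * f"
    using MH_D(3)[OF m(4)] MH_D(2)[OF m(3)] by (simp add: algebra_simps)
  also have "\<dots> = one (und A)"
    using eq MH_D(4)[OF m(3)] i by (simp add: mult.assoc)
  finally show ?thesis
    using m MH_D(1)[OF m(3)] MH_D(1)[OF m(4)] unfolding contractible_def by blast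
qed

end

section \<open>Contractible factorizations over a local ring\<close>

lemma sum_list_const_mult_mult: "(\<Sum>x\<leftarrow>xs. a * f x * b) = (a :: 'a::ring) * (\<Sum>x\<leftarrow>xs. f x) * b"
  by (simp add: sum_list_const_mult sum_list_mult_const)

text \<open>The set \<open>L\<close> models the objects P_x: their endomorphisms are scalars, and
  every identity is a sum of maps through them. The norm of a + b\<surd>t is
  \<open>a * a - t * (b * b)\<close>, so the last two assumptions imply that R[\<surd>t] is
  local.\<close>

locale local_factorizations = factorizations Ob H one \<kappa> t MO und dif
  for Ob :: "'o set" and H :: "'o \<Rightarrow> 'o \<Rightarrow> 'a::ring set" and one :: "'o \<Rightarrow> 'a"
    and \<kappa> :: "'r::comm_ring_1 \<Rightarrow> 'a" and t :: 'r
    and MO :: "'b set" and und :: "'b \<Rightarrow> 'o" and dif :: "'b \<Rightarrow> 'a" +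
  fixes L :: "'o set"
  assumes L_scalar: "\<lbrakk>X \<in> L; f \<in> H X X\<rbrakk> \<Longrightarrow> \<exists>r. f = \<kappa> r * one X"
    and one_decomposition: "P \<in> Ob \<Longrightarrow>
      \<exists>xs. (\<forall>(X, u, g)\<in>set xs. X \<in> L \<and> u \<in> H X P \<and> g \<in> H P X) \<and> one P = (\<Sum>(X, u, g)\<leftarrow>xs. u * g)"
    and local_ring: "(a :: 'r) dvd 1 \<or> 1 - a dvd 1"
    and norm_unit: "a dvd 1 \<Longrightarrow> a * a - t * (b * b) dvd 1"
begin

definition factor_list :: "'o \<Rightarrow> ('o \<times> 'a \<times> 'a) list \<Rightarrow> bool" where
  "factor_list P xs \<longleftrightarrow> (\<forall>(X, u, g)\<in>set xs. X \<in> L \<and> u \<in> H X P \<and> g \<in> H P X)"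

definition factor_sum :: "('o \<times> 'a \<times> 'a) list \<Rightarrow> 'a" where
  "factor_sum xs = (\<Sum>(X, u, g)\<leftarrow>xs. u * g)"

lemma factor_sum_H: "\<lbrakk>factor_list P xs; P \<in> Ob\<rbrakk> \<Longrightarrow> factor_sum xs \<in> H P P"
  by (induction xs) (auto simp: factor_list_def factor_sum_def)

text \<open>Multiplication on both sides keeps the number of terms, on which the splitting argument
  is an induction.\<close>

lemma factor_list_conj:
  assumes "factor_list P xs" "e \<in> H P P" "z \<in> H P P"
  obtains ys where "length ys = length xs" "factor_list P ys" "factor_sum ys = e * factor_sum xs * z"
proof
  let ?ys = "map (\<lambda>(X, u, g). (X, e * u, g * z)) xs"
  show "length ?ys = length xs"
    by simp
  show "factor_list P ?ys"
    using assms by (force simp: factor_list_def)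
  show "factor_sum ?ys = e * factor_sum xs * z"
  proof -
    have "factor_sum ?ys = (\<Sum>x\<leftarrow>xs. e * (case x of (X, u, g) \<Rightarrow> u * g) * z)"
      by (simp add: factor_sum_def o_def case_prod_unfold mult.assoc)
    then show ?thesis
      by (simp only: sum_list_const_mult_mult factor_sum_def)
  qed
qed

lemma scale_zero: "\<kappa> 0 = 0"
  using scale_add[of 0 0] by simp

text \<open>The maps \<open>u\<close> and \<open>g\<close> give an endomorphism of the double of \<open>X\<close> that acts as \<open>a + b\<surd>t\<close>;
  its norm is \<open>a\<^sup>2 - t b\<^sup>2\<close>.\<close>

lemma unit_summand:
  assumes A: "A \<in> MO" and e: "e \<in> H (und A) (und A)" "e * e = e" "dif A * e = e * dif A"
    and X: "X \<in> Ob" and u: "u \<in> H X (und A)" "e * u = u" and g: "g \<in> H (und A) X" "g * e = g"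
    and a: "g * (dif A * u) = \<kappa> a * one X" "a dvd 1" and b: "g * u = \<kappa> b * one X"
  obtains u' where "u' \<in> H X (und A)" "e * u' = u'" "g * (dif A * u') = one X" "g * u' = 0"
proof -
  obtain w where w: "(a * a - t * (b * b)) * w = 1"
    using norm_unit[OF a(2), of b] by (metis dvdE)
  \<comment> \<open>Here \<surd>t acts on \<open>u\<close> through \<open>dif A\<close>, and w(a -
    b\<surd>t) is the inverse of a + b\<surd>t, so \<open>?u\<close> is \<open>u\<close> multiplied
    by that inverse.\<close>
  let ?u = "\<kappa> (a * w) * u + \<kappa> (- (b * w)) * (dif A * u)"
  show ?thesis
  proof
    show "?u \<in> H X (und A)"
      using u dif_H[OF A] by blast
    have "e * (dif A * u) = dif A * u"
      using e(3) u(2) by (metis mult.assoc)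
    then show "e * ?u = ?u"
      using e(1) u by (simp add: algebra_simps H_simps)
    have "g * (dif A * ?u) = \<kappa> (a * w) * (\<kappa> a * one X) + \<kappa> (- (b * w)) * (\<kappa> t * (\<kappa> b * one X))"
      using g(1) u(1) A by (simp add: algebra_simps H_simps dif_simps a b)
    also have "\<dots> = \<kappa> (a * w * a + - (b * w) * (t * b)) * one X"
      by (simp only: scale_add scale_mult) (simp add: algebra_simps)
    also have "a * w * a + - (b * w) * (t * b) = 1"
      using w by (simp add: algebra_simps)
    finally show "g * (dif A * ?u) = one X"
      by simp
    have "g * ?u = \<kappa> (a * w) * (\<kappa> b * one X) + \<kappa> (- (b * w)) * (\<kappa> a * one X)"
      using g(1) u(1) A by (simp add: algebra_simps H_simps dif_simps a b)
    also have "\<dots> = \<kappa> (a * w * b + - (b * w) * a) * one X"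
      by (simp only: scale_add scale_mult) (simp add: algebra_simps)
    finally show "g * ?u = 0"
      by (simp add: algebra_simps scale_zero)
  qed
qed

text \<open>The map subtracted from \<open>e\<close>, called \<open>S\<close> in the proof,
  satisfies S * S = (a + b\<surd>t) S with \<surd>t acting as \<open>dif A\<close>. As 1 - a is a
  unit, so is 1 - a - b\<surd>t, and e + S/(1 - a - b\<surd>t) is a right inverse of e - S relative
  to \<open>e\<close>.\<close>

lemma nonunit_summand:
  assumes A: "A \<in> MO" and X: "X \<in> Ob"
    and e: "e \<in> H (und A) (und A)" "e * e = e" "dif A * e = e * dif A"
    and u: "u \<in> H X (und A)" "e * u = u" and g: "g \<in> H (und A) X" "g * e = g"
    and a: "g * (dif A * u) = \<kappa> a * one X" "1 - a dvd 1" and b: "g * u = \<kappa> b * one X"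
  obtains z where "z \<in> H (und A) (und A)" "dif A * z = z * dif A"
    "(e - (dif A * (u * g) + u * (g * dif A))) * z = e"
proof -
  obtain w where w: "((1 - a) * (1 - a) - t * (b * b)) * w = 1"
    using norm_unit[OF a(2), of b] by (metis dvdE)
  define S where "S = dif A * (u * g) + u * (g * dif A)"
  \<comment> \<open>This is \<open>dif A * S\<close>, that is, \<surd>t times \<open>S\<close>; the
    span of \<open>S\<close> and \<open>N\<close> is closed under multiplication by
    \<open>S\<close>.\<close>
  define N where "N = \<kappa> t * (u * g) + dif A * (u * (g * dif A))"
  have au: "g * (dif A * (u * x)) = \<kappa> a * (one X * x)" and bu: "g * (u * x) = \<kappa> b * (one X * x)" for x
    using mult_left_eq[OF a(1)] mult_left_eq[OF b] by (simp_all add: mult.assoc)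
  have H: "S \<in> H (und A) (und A)" "N \<in> H (und A) (und A)"
    unfolding S_def N_def using u(1) g(1) dif_H[OF A] by blast+
  have S_comm: "dif A * S = S * dif A" and N_comm: "dif A * N = N * dif A"
    using u(1) g(1) A by (simp_all add: S_def N_def algebra_simps dif_simps H_simps)
  have comm: "\<kappa> t * (\<kappa> b * x) = \<kappa> b * (\<kappa> t * x)" "\<kappa> t * (\<kappa> a * x) = \<kappa> a * (\<kappa> t * x)" for x
    by (metis scale_central mult.assoc)+
  have SS: "S * S = \<kappa> a * S + \<kappa> b * N"
    using u(1) g(1) A by (simp add: S_def N_def algebra_simps dif_simps H_simps au bu comm)
  have SN: "S * N = \<kappa> a * N + \<kappa> (t * b) * S"
    using u(1) g(1) A by (simp add: S_def N_def algebra_simps dif_simps H_simps au bu comm scale_mult)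
  have eS: "e * S = S" "S * e = S"
  proof -
    have "e * (dif A * (u * g)) = dif A * (u * g)"
      using e(3) u(2) by (metis mult.assoc)
    then show "e * S = S"
      by (simp add: S_def algebra_simps mult_left_eq[OF u(2)])
    have "g * (dif A * e) = g * dif A"
      using e(3) g(2) by (metis mult.assoc)
    then show "S * e = S"
      by (simp add: S_def algebra_simps g(2))
  qed
  have eN: "e * N = N"
  proof -
    have "e * (dif A * (u * (g * dif A))) = dif A * (u * (g * dif A))"
      using e(3) u(2) by (metis mult.assoc)
    then show ?thesis
      using e(1) by (simp add: N_def algebra_simps H_simps mult_left_eq[OF u(2)])
  qed
  \<comment> \<open>The inverse of 1 - a - b\<surd>t is w(1 - a + b\<surd>t), and \<open>y\<close>
    is that multiple of \<open>S\<close>; hence \<open>S + S * y = y\<close>.\<close>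
  define y where "y = \<kappa> (w * (1 - a)) * S + \<kappa> (w * b) * N"
  have "S + S * y = \<kappa> 1 * S + (\<kappa> (w * (1 - a)) * (\<kappa> a * S + \<kappa> b * N) + \<kappa> (w * b) * (\<kappa> a * N + \<kappa> (t * b) * S))"
    using H by (simp add: y_def algebra_simps H_simps SS SN)
  also have "\<dots> = \<kappa> (1 + w * (1 - a) * a + w * b * (t * b)) * S + \<kappa> (w * (1 - a) * b + w * b * a) * N"
    by (simp only: scale_add scale_mult) (simp add: algebra_simps)
  also have "1 + w * (1 - a) * a + w * b * (t * b) = w * (1 - a)"
    using w by (simp add: algebra_simps)
  also have "w * (1 - a) * b + w * b * a = w * b"
    by (simp add: algebra_simps)
  finally have Sy: "S + S * y = y"
    by (simp add: y_def)
  show ?thesis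
  proof
    show "e + y \<in> H (und A) (und A)"
      unfolding y_def using e(1) H by blast
    show "dif A * (e + y) = (e + y) * dif A"
      using H A by (simp add: y_def algebra_simps e(3) S_comm N_comm dif_simps H_simps)
    have ey: "e * y = y"
      using e(1) by (simp add: y_def algebra_simps H_simps eS eN)
    have "(e - S) * (e + y) = e + y - (S + S * y)"
      by (simp add: algebra_simps e(2) eS ey)
    then show "(e - (dif A * (u * g) + u * (g * dif A))) * (e + y) = e"
      using Sy by (simp flip: S_def)
  qed
qed

lemma null_homotopic_idempotent_splits:
  assumes A: "A \<in> MO"
    and "e \<in> H (und A) (und A)" "e * e = e" "dif A * e = e * dif A"
    and "factor_list (und A) xs" "e = dif A * factor_sum xs + factor_sum xs * dif A"
  shows "\<exists>Q\<in>Ob. \<exists>u\<in>H Q (und A). \<exists>g\<in>H (und A) Q. g * (dif A * u) = one Q \<and> g * u = 0 \<and>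
     dif A * (u * g) + u * (g * dif A) = e"
  using assms(2-)
proof (induction "length xs" arbitrary: xs e)
  case 0
  obtain Z where "Z \<in> Ob" "one Z = 0"
    using zero_Ob by blast
  with 0 A show ?case
    by (intro bexI[of _ Z] bexI[of _ 0]) (auto simp: factor_sum_def)
next
  case (Suc n)
  note e = Suc.prems(1-3)
  let ?d = "dif A"
  obtain X u\<^sub>0 g\<^sub>0 ys where xs: "xs = (X, u\<^sub>0, g\<^sub>0) # ys" "n = length ys"
    using Suc.hyps(2) by (cases xs) auto
  then have X: "X \<in> L" "X \<in> Ob" "u\<^sub>0 \<in> H X (und A)" "g\<^sub>0 \<in> H (und A) X" and ys: "factor_list (und A) ys"
    using Suc.prems(4) H_Ob by (auto simp: factor_list_def)
  define u where "u = e * u\<^sub>0"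
  define g where "g = g\<^sub>0 * e"
  define h where "h = factor_sum ys"
  have u: "u \<in> H X (und A)" "e * u = u" and g: "g \<in> H (und A) X" "g * e = g"
    using e X by (auto simp: u_def g_def mult.assoc mult_left_eq[OF e(2)])
  have hH: "h \<in> H (und A) (und A)"
    unfolding h_def using ys A by (auto intro: factor_sum_H)
  have de: "e * (?d * x) = ?d * (e * x)" for x
    using e(3) by (metis mult.assoc)
  \<comment> \<open>Conjugating the homotopy formula by \<open>e\<close> cuts every term down to the
    summand: the first one appears with \<open>u\<close> and \<open>g\<close>, the others with
    \<open>e * h * e\<close>.\<close>
  have "e = e * e * e"
    using e(2) by simp
  also have "\<dots> = e * (?d * (u\<^sub>0 * g\<^sub>0 + h) + (u\<^sub>0 * g\<^sub>0 + h) * ?d) * e"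
    using Suc.prems(5) by (simp add: xs factor_sum_def h_def case_prod_unfold)
  also have "\<dots> = ?d * (u * g) + u * (g * ?d) + (?d * (e * (h * e)) + e * (h * (e * ?d)))"
    by (simp add: u_def g_def algebra_simps de e(3))
  finally have eq: "e = ?d * (u * g) + u * (g * ?d) + (?d * (e * (h * e)) + e * (h * (e * ?d)))" .
  have "g * (?d * u) \<in> H X X" "g * u \<in> H X X"
    using u g dif_H[OF A] by blast+
  then obtain a b where a: "g * (?d * u) = \<kappa> a * one X" and b: "g * u = \<kappa> b * one X"
    using L_scalar[OF X(1)] by meson
  show ?case
    using local_ring[of a]
  proof
    assume "1 - a dvd 1"
    then obtain z where z: "z \<in> H (und A) (und A)" "?d * z = z * ?d"
      "(e - (?d * (u * g) + u * (g * ?d))) * z = e"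
      using nonunit_summand[OF A X(2) e u g a _ b] by blast
    obtain zs where zs: "length zs = length ys" "factor_list (und A) zs"
      "factor_sum zs = e * h * (e * z)"
      using factor_list_conj[OF ys, of e "e * z"] e(1) z(1) unfolding h_def by blast
    \<comment> \<open>By \<open>eq\<close>, subtracting the first term from \<open>e\<close> leaves
      the contribution of \<open>h\<close>. Multiplication by \<open>z\<close>, which commutes with
      \<open>?d\<close>, turns it into a homotopy formula for \<open>e\<close> with one term
      fewer.\<close>
    have "e = (?d * (e * (h * e)) + e * (h * (e * ?d))) * z"
      using z(3) eq by (metis add_diff_cancel_left')
    also have "\<dots> = ?d * factor_sum zs + factor_sum zs * ?d"
      by (simp add: zs(3) algebra_simps z(2))
    finally show ?thesis
      using Suc.hyps(1)[OF _ e zs(2)] zs(1) xs(2) by simp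
  next
    assume "a dvd 1"
    then obtain u' where u': "u' \<in> H X (und A)" "e * u' = u'" "g * (?d * u') = one X" "g * u' = 0"
      using unit_summand[OF A e X(2) u g a _ b] by blast
    \<comment> \<open>The idempotent of the copy of the double of \<open>X\<close> that splits off;
      \<open>e'\<close> is the complementary part of \<open>e\<close>.\<close>
    define f where "f = ?d * (u' * g) + u' * (g * ?d)"
    define e' where "e' = e - f"
    have fH: "f \<in> H (und A) (und A)"
      unfolding f_def using u' g dif_H[OF A] by blast
    have e'H: "e' \<in> H (und A) (und A)"
      unfolding e'_def using e(1) fH by blast
    note u'_rules = u'(2-4) u'(2-4)[THEN mult_left_eq]
    have gdu: "g * (?d * (u' * x)) = one X * x" for x
      using u'(3) by (metis mult.assoc)
    have gde: "g * (?d * e) = g * ?d"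
      using e(3) g(2) by (metis mult.assoc)
    have fd: "?d * f = f * ?d"
      using u'(1) g(1) A by (simp add: f_def algebra_simps dif_simps H_simps)
    then have e'd: "?d * e' = e' * ?d"
      using e(3) by (simp add: e'_def algebra_simps)
    have ef: "e * f = f" "f * e = f" and ff: "f * f = f"
      using u'(1) g A by (simp_all add: f_def algebra_simps de u'_rules gde gdu H_simps dif_simps)
    then have e'e': "e' * e' = e'" and ee': "e * e' = e'" "e' * e = e'"
      using e(2) by (simp_all add: e'_def algebra_simps)
    have ge': "g * e' = 0"
      using u'(1) g A by (simp add: e'_def f_def algebra_simps u'_rules gdu H_simps dif_simps)
    have e'u': "e' * u' = 0"
      using u'(1) g A by (simp add: e'_def f_def algebra_simps u'_rules gdu H_simps dif_simps)
    have gde': "g * (?d * e') = 0"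
      by (metis e'd ge' mult.assoc mult_zero_left)
    obtain zs where zs: "length zs = length ys" "factor_list (und A) zs"
      "factor_sum zs = e' * h * e'"
      using factor_list_conj[OF ys, of e' e'] e'H unfolding h_def by blast
    have e'd': "e' * (?d * x) = ?d * (e' * x)" for x
      using e'd by (metis mult.assoc)
    have "e' = e' * e * e'"
      using e'e' ee' by (simp add: mult.assoc)
    also have "\<dots> = e' * (?d * (u * g) + u * (g * ?d) + (?d * (e * (h * e)) + e * (h * (e * ?d)))) * e'"
      using eq by simp
    \<comment> \<open>Compression by \<open>e'\<close> kills the first term because
      \<open>g * e'\<close> and \<open>g * (?d * e')\<close> vanish.\<close>
    also have "\<dots> = ?d * (e' * (h * e')) + e' * (h * (e' * ?d))"
    proof -
      have "e' * (?d * (e * x)) = ?d * (e' * x)" "e' * (e * x) = e' * x" "e * (?d * e') = e' * ?d" for x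
        using ee' e'd by (metis mult.assoc)+
      then show ?thesis
        by (simp add: algebra_simps ge' ge'[THEN mult_left_eq] gde' ee' e'd)
    qed
    finally have "e' = ?d * factor_sum zs + factor_sum zs * ?d"
      by (simp add: zs(3) algebra_simps)
    then obtain Q v k where Q: "Q \<in> Ob" and v: "v \<in> H Q (und A)" and k: "k \<in> H (und A) Q"
      and r: "k * (?d * v) = one Q" "k * v = 0" and e'eq: "?d * (v * k) + v * (k * ?d) = e'"
      using Suc.hyps(1)[OF _ e'H e'e' e'd zs(2)] zs(1) xs(2) by auto
    have kdv: "k * (?d * (v * x)) = one Q * x" for x
      using r(1) by (metis mult.assoc)
    have ke': "k * e' = k"
      using k v A by (simp add: algebra_simps r kdv r(2)[THEN mult_left_eq] H_simps dif_simps flip: e'eq)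
    have e'v: "e' * v = v"
      using k v A by (simp add: algebra_simps r kdv r(2)[THEN mult_left_eq] H_simps dif_simps flip: e'eq)
    \<comment> \<open>Since \<open>k\<close> and \<open>v\<close> absorb \<open>e'\<close>, which
      annihilates \<open>u'\<close> and \<open>g\<close>, the two splittings are orthogonal and can
      be added along a biproduct of \<open>Q\<close> and \<open>X\<close>.\<close>
    have cross: "k * u' = 0" "k * (?d * u') = 0" "g * v = 0" "g * (?d * v) = 0"
    proof -
      show "k * u' = 0" "g * v = 0"
        using ke' e'u' e'v ge' by (metis mult.assoc mult_zero_right mult_zero_left)+
      have "k * (?d * u') = k * (e' * (?d * u'))"
        using ke' by (metis mult.assoc)
      then show "k * (?d * u') = 0"
        by (simp add: e'd' e'u')
      have "g * (?d * v) = g * (?d * (e' * v))"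
        using e'v by simp
      then show "g * (?d * v) = 0"
        using gde' by (metis mult.assoc mult_zero_left)
    qed
    have cross': "k * (?d * (u' * x)) = 0" "g * (?d * (v * x)) = 0" for x
      using cross(2,4) by (metis mult.assoc mult_zero_left)+
    obtain S i\<^sub>1 i\<^sub>2 p\<^sub>1 p\<^sub>2 where c: "biprod Q X S i\<^sub>1 i\<^sub>2 p\<^sub>1 p\<^sub>2"
      using biprod_exists[OF Q X(2)] by blast
    note c' = biprodD[OF c]
    let ?u = "v * p\<^sub>1 + u' * p\<^sub>2" and ?g = "i\<^sub>1 * k + i\<^sub>2 * g"
    have "?u \<in> H S (und A)" "?g \<in> H (und A) S"
      using c' u' g v k by blast+
    moreover have "?g * (?d * ?u) = one S" "?g * ?u = 0"
      using c'(1-4)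
      by (simp_all add: algebra_simps cross cross[THEN mult_left_eq] cross' u'_rules
          r r[THEN mult_left_eq] kdv gdu c'(5-) H_simps)
    moreover have "?d * (?u * ?g) + ?u * (?g * ?d) = e"
    proof -
      have "?u * ?g = v * k + u' * g"
        using u'(1) v k g by (simp add: algebra_simps biprod_rules(1-4)[OF c] H_simps)
      then have "?d * (?u * ?g) + ?u * ?g * ?d = (?d * (v * k) + v * (k * ?d)) + f"
        unfolding f_def by (simp only:) (simp add: algebra_simps)
      then show ?thesis
        by (simp add: e'eq e'_def mult.assoc)
    qed
    ultimately show ?thesis
      using c'(7) by blast
  qed
qed

lemma contractible_isomorphic_double:
  assumes "contractible A"
  shows "\<exists>Q\<in>Ob. \<forall>G i\<^sub>1 i\<^sub>2 p\<^sub>1 p\<^sub>2. is_double Q G i\<^sub>1 i\<^sub>2 p\<^sub>1 p\<^sub>2 \<longrightarrow> isomorphic mf A G"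
proof -
  obtain h where A: "A \<in> MO" and h: "h \<in> H (und A) (und A)" "dif A * h + h * dif A = one (und A)"
    using assms by (auto simp: contractible_def)
  obtain xs where xs: "factor_list (und A) xs" "one (und A) = factor_sum xs"
    using one_decomposition[OF und_Ob[OF A]] unfolding factor_list_def factor_sum_def by blast
  \<comment> \<open>Multiplying a decomposition of the identity by \<open>h\<close> writes
    \<open>h\<close> itself as a sum of maps through objects of \<open>L\<close>.\<close>
  obtain ys where ys: "factor_list (und A) ys" "factor_sum ys = h * factor_sum xs * one (und A)"
    using factor_list_conj[OF xs(1) h(1) one_H[OF und_Ob[OF A]]] by blast
  have "factor_sum ys = h"
    using h(1) by (simp add: ys(2) H_simps flip: xs(2))
  then have "one (und A) = dif A * factor_sum ys + factor_sum ys * dif A"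
    using h(2) by simp
  moreover have "one (und A) * one (und A) = one (und A)" "dif A * one (und A) = one (und A) * dif A"
    using A by (simp_all add: one_left[OF one_H] dif_simps)
  ultimately obtain Q u g where Q: "Q \<in> Ob" and u: "u \<in> H Q (und A)" and g: "g \<in> H (und A) Q"
    and r: "g * (dif A * u) = one Q" "g * u = 0" "dif A * (u * g) + u * (g * dif A) = one (und A)"
    using null_homotopic_idempotent_splits[OF A one_H[OF und_Ob[OF A]] _ _ ys(1)] by blast
  have "isomorphic mf A G" if "is_double Q G i\<^sub>1 i\<^sub>2 p\<^sub>1 p\<^sub>2" for G i\<^sub>1 i\<^sub>2 p\<^sub>1 p\<^sub>2
  proof -
    have b: "biprod Q Q (und G) i\<^sub>1 i\<^sub>2 p\<^sub>1 p\<^sub>2" and G: "G \<in> MO" "dif G = i\<^sub>2 * p\<^sub>1 + \<kappa> t * (i\<^sub>1 * p\<^sub>2)"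
      using that by (auto simp: is_double_def)
    note b' = biprodD[OF b]
    \<comment> \<open>The column with entries \<open>g * dif A\<close>, \<open>g\<close> and the row
      with entries \<open>u\<close>, \<open>dif A * u\<close>. Their product \<open>?f * ?k\<close>
      has \<open>g * (dif A * u)\<close> on the diagonal and multiples of \<open>g * u\<close> off
      it.\<close>
    let ?f = "i\<^sub>1 * (g * dif A) + i\<^sub>2 * g" and ?k = "u * p\<^sub>1 + dif A * (u * p\<^sub>2)"
    have "?f \<in> H (und A) (und G)" "?k \<in> H (und G) (und A)"
      using b' u g dif_H[OF A] by blast+
    then have "?f \<in> MH A G" "?k \<in> MH G A"
      using b'(1-4) u g A
      by (simp_all add: MH_def G(2) algebra_simps b'(5-) biprod_rules[OF b] H_simps dif_simps)
    moreover have "?k * ?f = dif A * (u * g) + u * (g * dif A)"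
      using b'(1-4) u g A
      by (simp add: algebra_simps biprod_rules(1-4)[OF b] H_simps)
    moreover have "g * (dif A * (u * x)) = one Q * x" for x
      using r(1) by (metis mult.assoc)
    then have "?f * ?k = one (und G)"
      using b'(1-4) u g A
      by (simp add: algebra_simps b'(5-) r r(1,2)[THEN mult_left_eq] H_simps dif_simps)
    ultimately show ?thesis
      using A G(1) r(3) by (auto simp: isomorphic_def is_iso_def)
  qed
  then show ?thesis
    using Q by blast
qed

end

section \<open>Transport of the Frobenius structure\<close>

lemma ex1_cong: "(\<And>x. \<phi> x \<longleftrightarrow> \<psi> x) \<Longrightarrow> (\<exists>!x. \<phi> x) \<longleftrightarrow> (\<exists>!x. \<psi> x)"
  by simp

text \<open>An isomorphism of categories that is the identity on objects. The map on morphisms takes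
  source and target as arguments because hom sets may overlap.\<close>

locale category_iso =
  fixes C :: "('o, 'm, 'z) precat_scheme" and C' :: "('o, 'n, 'y) precat_scheme"
    and \<rho> :: "'o \<Rightarrow> 'o \<Rightarrow> 'm \<Rightarrow> 'n"
    and E :: "('o, 'm) seq_class" and E' :: "('o, 'n) seq_class"
  assumes Obj_eq [simp]: "Obj C' = Obj C"
    and bij: "\<lbrakk>A \<in> Obj C; B \<in> Obj C\<rbrakk> \<Longrightarrow> bij_betw (\<rho> A B) (Hom C A B) (Hom C' A B)"
    and Idn_in [simp]: "A \<in> Obj C \<Longrightarrow> Idn C A \<in> Hom C A A"
    and Zero_in [simp]: "\<lbrakk>A \<in> Obj C; B \<in> Obj C\<rbrakk> \<Longrightarrow> Zero C A B \<in> Hom C A B"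
    and Plus_in [simp]: "\<lbrakk>A \<in> Obj C; B \<in> Obj C; f \<in> Hom C A B; g \<in> Hom C A B\<rbrakk>
      \<Longrightarrow> Plus C A B f g \<in> Hom C A B"
    and Comp_in [simp]: "\<lbrakk>A \<in> Obj C; B \<in> Obj C; D \<in> Obj C; f \<in> Hom C A B; g \<in> Hom C B D\<rbrakk>
      \<Longrightarrow> Comp C A B D g f \<in> Hom C A D"
    and Idn_map [simp]: "A \<in> Obj C \<Longrightarrow> \<rho> A A (Idn C A) = Idn C' A"
    and Zero_map [simp]: "\<lbrakk>A \<in> Obj C; B \<in> Obj C\<rbrakk> \<Longrightarrow> \<rho> A B (Zero C A B) = Zero C' A B"
    and Plus_map [simp]: "\<lbrakk>A \<in> Obj C; B \<in> Obj C; f \<in> Hom C A B; g \<in> Hom C A B\<rbrakk>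
      \<Longrightarrow> \<rho> A B (Plus C A B f g) = Plus C' A B (\<rho> A B f) (\<rho> A B g)"
    and Comp_map [simp]: "\<lbrakk>A \<in> Obj C; B \<in> Obj C; D \<in> Obj C; f \<in> Hom C A B; g \<in> Hom C B D\<rbrakk>
      \<Longrightarrow> \<rho> A D (Comp C A B D g f) = Comp C' A B D (\<rho> B D g) (\<rho> A B f)"
    and E_in: "E A B D f g \<Longrightarrow> A \<in> Obj C \<and> B \<in> Obj C \<and> D \<in> Obj C \<and> f \<in> Hom C A B \<and> g \<in> Hom C B D"
    and E'_in: "E' A B D f' g' \<Longrightarrow> A \<in> Obj C \<and> B \<in> Obj C \<and> D \<in> Obj C \<and> f' \<in> Hom C' A B \<and> g' \<in> Hom C' B D"
    and E_iff: "\<lbrakk>A \<in> Obj C; B \<in> Obj C; D \<in> Obj C; f \<in> Hom C A B; g \<in> Hom C B D\<rbrakk>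
      \<Longrightarrow> E A B D f g \<longleftrightarrow> E' A B D (\<rho> A B f) (\<rho> B D g)"
begin

lemma map_in [simp]: "\<lbrakk>A \<in> Obj C; B \<in> Obj C; f \<in> Hom C A B\<rbrakk> \<Longrightarrow> \<rho> A B f \<in> Hom C' A B"
  using bij by (metis bij_betwE)

lemma Hom_eq: "\<lbrakk>A \<in> Obj C; B \<in> Obj C\<rbrakk> \<Longrightarrow> Hom C' A B = \<rho> A B ` Hom C A B"
  using bij by (metis bij_betw_imp_surj_on)

lemma map_eq_iff:
  "\<lbrakk>A \<in> Obj C; B \<in> Obj C; f \<in> Hom C A B; g \<in> Hom C A B\<rbrakk> \<Longrightarrow> f = g \<longleftrightarrow> \<rho> A B f = \<rho> A B g"
  using bij_betw_imp_inj_on[OF bij, of A B] by (auto dest: inj_onD)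

lemma ball_Hom: "\<lbrakk>A \<in> Obj C; B \<in> Obj C\<rbrakk> \<Longrightarrow> (\<forall>f\<in>Hom C' A B. \<phi> f) \<longleftrightarrow> (\<forall>f\<in>Hom C A B. \<phi> (\<rho> A B f))"
  by (simp add: Hom_eq)

lemma bex_Hom: "\<lbrakk>A \<in> Obj C; B \<in> Obj C\<rbrakk> \<Longrightarrow> (\<exists>f\<in>Hom C' A B. \<phi> f) \<longleftrightarrow> (\<exists>f\<in>Hom C A B. \<phi> (\<rho> A B f))"
  by (simp add: Hom_eq)

lemma ex1_Hom:
  assumes "A \<in> Obj C" "B \<in> Obj C"
  shows "(\<exists>!f. f \<in> Hom C' A B \<and> \<phi> f) \<longleftrightarrow> (\<exists>!f. f \<in> Hom C A B \<and> \<phi> (\<rho> A B f))"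
proof -
  have inj: "inj_on (\<rho> A B) (Hom C A B)"
    using bij[OF assms] by (rule bij_betw_imp_inj_on)
  show ?thesis
  proof
    assume "\<exists>!f. f \<in> Hom C' A B \<and> \<phi> f"
    then obtain f where f: "f \<in> Hom C A B" "\<phi> (\<rho> A B f)"
      and uniq: "\<And>f'. f' \<in> Hom C' A B \<Longrightarrow> \<phi> f' \<Longrightarrow> f' = \<rho> A B f"
      unfolding Hom_eq[OF assms] by blast
    show "\<exists>!f. f \<in> Hom C A B \<and> \<phi> (\<rho> A B f)"
    proof (rule ex1I)
      show "g = f" if "g \<in> Hom C A B \<and> \<phi> (\<rho> A B g)" for g
        using that f(1) uniq[of "\<rho> A B g"] assms inj by (simp add: inj_on_eq_iff)
    qed (use f in blast)
  next
    assume "\<exists>!f. f \<in> Hom C A B \<and> \<phi> (\<rho> A B f)"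
    then show "\<exists>!f. f \<in> Hom C' A B \<and> \<phi> f"
      unfolding Hom_eq[OF assms] by blast
  qed
qed

section \<open>Transfer of isomorphisms, universal properties and exact sequences\<close>

lemma is_iso_map:
  assumes "A \<in> Obj C" "B \<in> Obj C" "f \<in> Hom C A B"
  shows "is_iso C' A B (\<rho> A B f) \<longleftrightarrow> is_iso C A B f"
  using assms by (auto simp: is_iso_def bex_Hom map_eq_iff[of A A] map_eq_iff[of B B])

lemma isomorphic_map: "isomorphic C' A B \<longleftrightarrow> isomorphic C A B"
proof
  assume "isomorphic C' A B"
  then obtain f' where f': "is_iso C' A B f'"
    by (auto simp: isomorphic_def)
  then have "A \<in> Obj C" "B \<in> Obj C" "f' \<in> Hom C' A B"
    by (auto simp: is_iso_def)
  with f' show "isomorphic C A B"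
    by (auto simp: Hom_eq is_iso_map isomorphic_def)
next
  assume "isomorphic C A B"
  then obtain f where f: "is_iso C A B f"
    by (auto simp: isomorphic_def)
  then have "A \<in> Obj C" "B \<in> Obj C" "f \<in> Hom C A B"
    by (auto simp: is_iso_def)
  with f show "isomorphic C' A B"
    by (auto simp: isomorphic_def simp flip: is_iso_map)
qed

lemma is_kernel_map:
  assumes "A \<in> Obj C" "B \<in> Obj C" "D \<in> Obj C" "i \<in> Hom C A B" "p \<in> Hom C B D"
  shows "is_kernel C' A B D (\<rho> A B i) (\<rho> B D p) \<longleftrightarrow> is_kernel C A B D i p"
proof -
  have "(\<exists>!k. k \<in> Hom C' T A \<and> Comp C' T A B (\<rho> A B i) k = \<rho> T B h) \<longleftrightarrow>
      (\<exists>!k. k \<in> Hom C T A \<and> Comp C T A B i k = h)" if "T \<in> Obj C" "h \<in> Hom C T B" for T h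
    using assms that unfolding ex1_Hom[OF that(1) assms(1)]
    by (intro ex1_cong) (auto simp: map_eq_iff[of T B])
  then show ?thesis
    using assms by (auto simp: is_kernel_def ball_Hom map_eq_iff[of _ D])
qed

lemma is_cokernel_map:
  assumes "A \<in> Obj C" "B \<in> Obj C" "D \<in> Obj C" "i \<in> Hom C A B" "p \<in> Hom C B D"
  shows "is_cokernel C' A B D (\<rho> A B i) (\<rho> B D p) \<longleftrightarrow> is_cokernel C A B D i p"
proof -
  have "(\<exists>!k. k \<in> Hom C' D T \<and> Comp C' B D T k (\<rho> B D p) = \<rho> B T h) \<longleftrightarrow>
      (\<exists>!k. k \<in> Hom C D T \<and> Comp C B D T k p = h)" if "T \<in> Obj C" "h \<in> Hom C B T" for T h
    using assms that unfolding ex1_Hom[OF assms(3) that(1)]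
    by (intro ex1_cong) (auto simp: map_eq_iff[of B T])
  then show ?thesis
    using assms by (auto simp: is_cokernel_def ball_Hom map_eq_iff[of A])
qed

lemma kernel_cokernel_pair_map:
  assumes "A \<in> Obj C" "B \<in> Obj C" "D \<in> Obj C" "i \<in> Hom C A B" "p \<in> Hom C B D"
  shows "kernel_cokernel_pair C' A B D (\<rho> A B i) (\<rho> B D p) \<longleftrightarrow> kernel_cokernel_pair C A B D i p"
  using assms by (simp add: kernel_cokernel_pair_def is_kernel_map is_cokernel_map)

lemma is_pushout_map:
  assumes "A \<in> Obj C" "B \<in> Obj C" "A' \<in> Obj C" "B' \<in> Obj C"
    "i \<in> Hom C A B" "f \<in> Hom C A A'" "i' \<in> Hom C A' B'" "f' \<in> Hom C B B'"
  shows "is_pushout C' A B A' B' (\<rho> A B i) (\<rho> A A' f) (\<rho> A' B' i') (\<rho> B B' f') \<longleftrightarrow>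
    is_pushout C A B A' B' i f i' f'"
proof -
  have "(\<exists>!k. k \<in> Hom C' B' T \<and> Comp C' B B' T k (\<rho> B B' f') = \<rho> B T u \<and>
        Comp C' A' B' T k (\<rho> A' B' i') = \<rho> A' T v) \<longleftrightarrow>
      (\<exists>!k. k \<in> Hom C B' T \<and> Comp C B B' T k f' = u \<and> Comp C A' B' T k i' = v)"
    if "T \<in> Obj C" "u \<in> Hom C B T" "v \<in> Hom C A' T" for T u v
    using assms that unfolding ex1_Hom[OF assms(4) that(1)]
    by (intro ex1_cong) (auto simp: map_eq_iff[of B T] map_eq_iff[of A' T])
  then show ?thesis
    using assms by (auto simp: is_pushout_def ball_Hom map_eq_iff[of A])
qed

lemma is_pullback_map:
  assumes "B \<in> Obj C" "D \<in> Obj C" "B' \<in> Obj C" "D' \<in> Obj C"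
    "p \<in> Hom C B D" "f \<in> Hom C D' D" "p' \<in> Hom C B' D'" "f' \<in> Hom C B' B"
  shows "is_pullback C' B D B' D' (\<rho> B D p) (\<rho> D' D f) (\<rho> B' D' p') (\<rho> B' B f') \<longleftrightarrow>
    is_pullback C B D B' D' p f p' f'"
proof -
  have "(\<exists>!k. k \<in> Hom C' T B' \<and> Comp C' T B' B (\<rho> B' B f') k = \<rho> T B u \<and>
        Comp C' T B' D' (\<rho> B' D' p') k = \<rho> T D' v) \<longleftrightarrow>
      (\<exists>!k. k \<in> Hom C T B' \<and> Comp C T B' B f' k = u \<and> Comp C T B' D' p' k = v)"
    if "T \<in> Obj C" "u \<in> Hom C T B" "v \<in> Hom C T D'" for T u v
    using assms that unfolding ex1_Hom[OF that(1) assms(3)]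
    by (intro ex1_cong) (auto simp: map_eq_iff[of T B] map_eq_iff[of T D'])
  then show ?thesis
    using assms by (auto simp: is_pullback_def ball_Hom map_eq_iff[of _ D])
qed

lemma inflation_map:
  assumes "A \<in> Obj C" "B \<in> Obj C" "f \<in> Hom C A B"
  shows "inflation E' A B (\<rho> A B f) \<longleftrightarrow> inflation E A B f"
proof
  assume "inflation E' A B (\<rho> A B f)"
  then obtain D g' where e: "E' A B D (\<rho> A B f) g'"
    by (auto simp: inflation_def)
  with E'_in[OF e] obtain g where "g \<in> Hom C B D" "g' = \<rho> B D g"
    by (auto simp: Hom_eq)
  then show "inflation E A B f"
    using e E'_in[OF e] assms by (auto simp: inflation_def simp flip: E_iff)
next
  assume "inflation E A B f"
  then obtain D g where e: "E A B D f g"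
    by (auto simp: inflation_def)
  then have "E' A B D (\<rho> A B f) (\<rho> B D g)"
    using E_in[OF e] by (simp flip: E_iff)
  then show "inflation E' A B (\<rho> A B f)"
    by (auto simp: inflation_def)
qed

lemma deflation_map:
  assumes "B \<in> Obj C" "D \<in> Obj C" "g \<in> Hom C B D"
  shows "deflation E' B D (\<rho> B D g) \<longleftrightarrow> deflation E B D g"
proof
  assume "deflation E' B D (\<rho> B D g)"
  then obtain A f' where e: "E' A B D f' (\<rho> B D g)"
    by (auto simp: deflation_def)
  with E'_in[OF e] obtain f where "f \<in> Hom C A B" "f' = \<rho> A B f"
    by (auto simp: Hom_eq)
  then show "deflation E B D g"
    using e E'_in[OF e] assms by (auto simp: deflation_def simp flip: E_iff)
next
  assume "deflation E B D g"
  then obtain A f where e: "E A B D f g"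
    by (auto simp: deflation_def)
  then have "E' A B D (\<rho> A B f) (\<rho> B D g)"
    using E_in[OF e] by (simp flip: E_iff)
  then show "deflation E' B D (\<rho> B D g)"
    by (auto simp: deflation_def)
qed

lemma inflation_in: "inflation E A B f \<Longrightarrow> A \<in> Obj C \<and> B \<in> Obj C \<and> f \<in> Hom C A B"
  and inflation'_in: "inflation E' A B f' \<Longrightarrow> A \<in> Obj C \<and> B \<in> Obj C \<and> f' \<in> Hom C' A B"
  and deflation_in: "deflation E A B f \<Longrightarrow> A \<in> Obj C \<and> B \<in> Obj C \<and> f \<in> Hom C A B"
  and deflation'_in: "deflation E' A B f' \<Longrightarrow> A \<in> Obj C \<and> B \<in> Obj C \<and> f' \<in> Hom C' A B"
  unfolding inflation_def deflation_def using E_in E'_in by blast+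

lemma projective_map: "projective_object C' E' P \<longleftrightarrow> projective_object C E P"
proof (cases "P \<in> Obj C")
  case P: True
  have "(\<forall>p h. deflation E' B D p \<longrightarrow> h \<in> Hom C' P D \<longrightarrow> (\<exists>k\<in>Hom C' P B. Comp C' P B D p k = h)) \<longleftrightarrow>
      (\<forall>p h. deflation E B D p \<longrightarrow> h \<in> Hom C P D \<longrightarrow> (\<exists>k\<in>Hom C P B. Comp C P B D p k = h))"
    (is "?l \<longleftrightarrow> ?r") for B D
  proof (cases "B \<in> Obj C \<and> D \<in> Obj C")
    case True
    \<comment> \<open>The quantifiers over \<open>p\<close> and \<open>h\<close> are first bounded
      by hom sets, because \<open>\<rho>\<close> transfers bounded quantifiers.\<close>
    then have "?l \<longleftrightarrow> (\<forall>p\<in>Hom C' B D. deflation E' B D p \<longrightarrow>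
        (\<forall>h\<in>Hom C' P D. \<exists>k\<in>Hom C' P B. Comp C' P B D p k = h))"
      using deflation'_in by blast
    also have "\<dots> \<longleftrightarrow> (\<forall>p\<in>Hom C B D. deflation E B D p \<longrightarrow>
        (\<forall>h\<in>Hom C P D. \<exists>k\<in>Hom C P B. Comp C P B D p k = h))"
      using P True by (simp add: ball_Hom bex_Hom deflation_map map_eq_iff[of P D])
    also have "\<dots> \<longleftrightarrow> ?r"
      using deflation_in by blast
    finally show ?thesis .
  next
    case False
    then show ?thesis
      using deflation_in deflation'_in by blast
  qed
  then show ?thesis
    by (simp add: projective_object_def)
qed (simp add: projective_object_def)

lemma injective_map: "injective_object C' E' I \<longleftrightarrow> injective_object C E I"
proof (cases "I \<in> Obj C")
  case I: True
  have "(\<forall>i h. inflation E' A B i \<longrightarrow> h \<in> Hom C' A I \<longrightarrow> (\<exists>k\<in>Hom C' B I. Comp C' A B I k i = h)) \<longleftrightarrow>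
      (\<forall>i h. inflation E A B i \<longrightarrow> h \<in> Hom C A I \<longrightarrow> (\<exists>k\<in>Hom C B I. Comp C A B I k i = h))"
    (is "?l \<longleftrightarrow> ?r") for A B
  proof (cases "A \<in> Obj C \<and> B \<in> Obj C")
    case True
    then have "?l \<longleftrightarrow> (\<forall>i\<in>Hom C' A B. inflation E' A B i \<longrightarrow>
        (\<forall>h\<in>Hom C' A I. \<exists>k\<in>Hom C' B I. Comp C' A B I k i = h))"
      using inflation'_in by blast
    also have "\<dots> \<longleftrightarrow> (\<forall>i\<in>Hom C A B. inflation E A B i \<longrightarrow>
        (\<forall>h\<in>Hom C A I. \<exists>k\<in>Hom C B I. Comp C A B I k i = h))"
      using I True by (simp add: ball_Hom bex_Hom inflation_map map_eq_iff[of A I])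
    also have "\<dots> \<longleftrightarrow> ?r"
      using inflation_in by blast
    finally show ?thesis .
  next
    case False
    then show ?thesis
      using inflation_in inflation'_in by blast
  qed
  then show ?thesis
    by (simp add: injective_object_def)
qed (simp add: injective_object_def)

section \<open>Transfer of the axioms\<close>

lemma preadditive_map:
  assumes "preadditive_category C'"
  shows "preadditive_category C"
proof -
  interpret C': preadditive_category C'
    by fact
  show ?thesis
  proof (unfold_locales, goal_cases)
    case (3 A B f)
    then show ?case
      by (simp add: map_eq_iff[of A B] C'.Idn_left)
  next
    case (4 A B f)
    then show ?case
      by (simp add: map_eq_iff[of A B] C'.Idn_right)
  next
    case (5 W A B D f g h)
    then show ?case
      by (simp add: map_eq_iff[of W D] C'.Comp_assoc)
  next
    case (8 A B f g h)
    then show ?case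
      by (simp add: map_eq_iff[of A B] C'.Plus_assoc)
  next
    case (9 A B f g)
    then show ?case
      by (simp add: map_eq_iff[of A B] C'.Plus_comm[of A B])
  next
    case (10 A B f)
    then show ?case
      by (simp add: map_eq_iff[of A B] C'.Plus_zero)
  next
    case (11 A B f)
    then have "\<exists>g\<in>Hom C' A B. Plus C' A B (\<rho> A B f) g = Zero C' A B"
      by (simp add: C'.Plus_inverse)
    with 11 show ?case
      by (simp add: bex_Hom map_eq_iff[of A B])
  next
    case (12 A B D f g h)
    then show ?case
      by (simp add: map_eq_iff[of A D] C'.Comp_Plus_left)
  next
    case (13 A B D f g h)
    then show ?case
      by (simp add: map_eq_iff[of A D] C'.Comp_Plus_right)
  qed simp_all
qed

lemma additive_map:
  assumes "additive_category C'"
  shows "additive_category C"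
proof -
  have "preadditive_category C"
    using assms preadditive_map by (simp add: additive_category_def)
  moreover have "\<exists>Z. zero_object C Z"
  proof -
    obtain Z where Z: "zero_object C' Z"
      using assms by (auto simp: additive_category_def)
    have one: "Hom C A B = {Zero C A B}" if "Hom C' A B = {Zero C' A B}" "A \<in> Obj C" "B \<in> Obj C" for A B
    proof -
      have "\<rho> A B f = \<rho> A B (Zero C A B)" if "f \<in> Hom C A B" for f
        using that \<open>Hom C' A B = _\<close> \<open>A \<in> _\<close> \<open>B \<in> _\<close> map_in[of A B f] by simp
      then show ?thesis
        using that map_eq_iff[of A B] by auto
    qed
    have "zero_object C Z"
      using Z one by (simp add: zero_object_def)
    then show ?thesis ..
  qed
  moreover have "\<exists>S i\<^sub>1 i\<^sub>2 p\<^sub>1 p\<^sub>2. is_biproduct C A B S i\<^sub>1 i\<^sub>2 p\<^sub>1 p\<^sub>2" if AB: "A \<in> Obj C" "B \<in> Obj C" for A B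
  proof -
    obtain S i\<^sub>1 i\<^sub>2 p\<^sub>1 p\<^sub>2 where b: "is_biproduct C' A B S i\<^sub>1 i\<^sub>2 p\<^sub>1 p\<^sub>2"
      using AB assms unfolding additive_category_def Obj_eq by blast
    then have S: "S \<in> Obj C"
      and "i\<^sub>1 \<in> Hom C' A S" "i\<^sub>2 \<in> Hom C' B S" "p\<^sub>1 \<in> Hom C' S A" "p\<^sub>2 \<in> Hom C' S B"
      by (auto simp: is_biproduct_def)
    then obtain j\<^sub>1 j\<^sub>2 q\<^sub>1 q\<^sub>2 where "j\<^sub>1 \<in> Hom C A S" "j\<^sub>2 \<in> Hom C B S" "q\<^sub>1 \<in> Hom C S A" "q\<^sub>2 \<in> Hom C S B"
      and "i\<^sub>1 = \<rho> A S j\<^sub>1" "i\<^sub>2 = \<rho> B S j\<^sub>2" "p\<^sub>1 = \<rho> S A q\<^sub>1" "p\<^sub>2 = \<rho> S B q\<^sub>2"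
      using AB by (auto simp: Hom_eq)
    then have "is_biproduct C A B S j\<^sub>1 j\<^sub>2 q\<^sub>1 q\<^sub>2"
      using b AB S by (simp add: is_biproduct_def map_eq_iff[of S S] map_eq_iff[of A] map_eq_iff[of B])
    then show ?thesis
      by blast
  qed
  ultimately show ?thesis
    by (simp add: additive_category_def)
qed

lemma exact_map:
  assumes "exact_category C' E'"
  shows "exact_category C E"
proof -
  interpret C': exact_category C' E'
    by fact
  show ?thesis
  proof (unfold_locales, goal_cases)
    case 1
    then show ?case
      using C'.additive additive_map by blast
  next
    case (2 A B D i p)
    then show ?case
      using E_in[OF 2] C'.exact_pair[of A B D "\<rho> A B i" "\<rho> B D p"]
      by (simp add: kernel_cokernel_pair_map flip: E_iff)
  next
    case (3 A B D f g A' a B' b D' d f' g')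
    note m = E_in[OF 3(1)]
    have m': "A' \<in> Obj C" "B' \<in> Obj C" "D' \<in> Obj C" "a \<in> Hom C A A'" "b \<in> Hom C B B'" "d \<in> Hom C D D'"
      using 3 by (auto simp: is_iso_def)
    have "E' A' B' D' (\<rho> A' B' f') (\<rho> B' D' g')"
    proof (rule C'.exact_iso)
      show "E' A B D (\<rho> A B f) (\<rho> B D g)"
        using 3 m E_iff by blast
      show "is_iso C' A A' (\<rho> A A' a)" "is_iso C' B B' (\<rho> B B' b)" "is_iso C' D D' (\<rho> D D' d)"
        using 3 m m' by (simp_all add: is_iso_map)
      show "\<rho> A' B' f' \<in> Hom C' A' B'" "\<rho> B' D' g' \<in> Hom C' B' D'"
        using 3 m' by simp_all
      show "Comp C' A B B' (\<rho> B B' b) (\<rho> A B f) = Comp C' A A' B' (\<rho> A' B' f') (\<rho> A A' a)"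
        using 3(5,7) m m' by (simp flip: Comp_map)
      show "Comp C' B D D' (\<rho> D D' d) (\<rho> B D g) = Comp C' B B' D' (\<rho> B' D' g') (\<rho> B B' b)"
        using 3(6,8) m m' by (simp flip: Comp_map)
    qed
    then show ?case
      using E_iff 3 m' by blast
  next
    case (4 A)
    then show ?case
      using C'.inflation_Idn[of A] by (simp flip: Idn_map add: inflation_map del: Idn_map)
  next
    case (5 A)
    then show ?case
      using C'.deflation_Idn[of A] by (simp flip: Idn_map add: deflation_map del: Idn_map)
  next
    case (6 A B i D j)
    then show ?case
      using inflation_in[OF 6(1)] inflation_in[OF 6(2)] C'.inflation_Comp[of A B "\<rho> A B i" D "\<rho> B D j"]
      by (simp flip: Comp_map add: inflation_map del: Comp_map)
  next
    case (7 A B i D j)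
    then show ?case
      using deflation_in[OF 7(1)] deflation_in[OF 7(2)] C'.deflation_Comp[of A B "\<rho> A B i" D "\<rho> B D j"]
      by (simp flip: Comp_map add: deflation_map del: Comp_map)
  next
    case (8 A B i A' f)
    note m = inflation_in[OF 8(1)]
    obtain B' i' f' where p: "is_pushout C' A B A' B' (\<rho> A B i) (\<rho> A A' f) i' f'" "inflation E' A' B' i'"
      using C'.inflation_pushout[of A B "\<rho> A B i" A' "\<rho> A A' f"] 8 m by (auto simp: inflation_map)
    then have B': "B' \<in> Obj C" "i' \<in> Hom C' A' B'" "f' \<in> Hom C' B B'"
      by (auto simp: is_pushout_def)
    then obtain j k where jk: "j \<in> Hom C A' B'" "i' = \<rho> A' B' j" "k \<in> Hom C B B'" "f' = \<rho> B B' k"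
      using 8(2) m by (auto simp: Hom_eq)
    have "is_pushout C A B A' B' i f j k \<and> inflation E A' B' j"
      using p 8 m B'(1) jk by (simp add: is_pushout_map inflation_map)
    then show ?case
      by blast
  next
    case (9 B D p D' f)
    note m = deflation_in[OF 9(1)]
    obtain B' p' f' where p: "is_pullback C' B D B' D' (\<rho> B D p) (\<rho> D' D f) p' f'" "deflation E' B' D' p'"
      using C'.deflation_pullback[of B D "\<rho> B D p" D' "\<rho> D' D f"] 9 m by (auto simp: deflation_map)
    then have B': "B' \<in> Obj C" "p' \<in> Hom C' B' D'" "f' \<in> Hom C' B' B"
      by (auto simp: is_pullback_def)
    then obtain j k where jk: "j \<in> Hom C B' D'" "p' = \<rho> B' D' j" "k \<in> Hom C B' B" "f' = \<rho> B' B k"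
      using 9(2) m by (auto simp: Hom_eq)
    have "is_pullback C B D B' D' p f j k \<and> deflation E B' D' j"
      using p 9 m B'(1) jk by (simp add: is_pullback_map deflation_map)
    then show ?case
      by blast
  qed
qed

lemma frobenius_map:
  assumes "frobenius_category C' E'"
  shows "frobenius_category C E"
proof -
  interpret C': frobenius_category C' E'
    by fact
  interpret exact_category C E
    using exact_map C'.exact_category_axioms by blast
  show ?thesis
  proof (unfold_locales, goal_cases)
    case (1 A)
    then obtain P p where P: "projective_object C' E' P" "deflation E' P A p"
      using C'.enough_projectives[of A] by auto
    with deflation'_in[OF P(2)] obtain q where "q \<in> Hom C P A" "p = \<rho> P A q"
      by (auto simp: Hom_eq)
    with P deflation'_in[OF P(2)] show ?case
      by (auto simp: projective_map deflation_map)
  next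
    case (2 A)
    then obtain P p where P: "injective_object C' E' P" "inflation E' A P p"
      using C'.enough_injectives[of A] by auto
    with inflation'_in[OF P(2)] obtain q where "q \<in> Hom C A P" "p = \<rho> A P q"
      by (auto simp: Hom_eq)
    with P inflation'_in[OF P(2)] show ?case
      by (auto simp: injective_map inflation_map)
  next
    case (3 A)
    then show ?case
      using C'.projective_iff_injective by (simp add: projective_map injective_map)
  qed
qed

end

section \<open>Linear maps and discrete valuation rings\<close>

definition linear_map :: "((nat \<Rightarrow> 'r::comm_ring_1) \<Rightarrow> nat \<Rightarrow> 'r) \<Rightarrow> bool" where
  "linear_map f \<longleftrightarrow> (\<forall>u v. f (\<lambda>i. u i + v i) = (\<lambda>i. f u i + f v i)) \<and>
     (\<forall>r v. f (\<lambda>i. r * v i) = (\<lambda>i. r * f v i))"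

text \<open>Matrices of all sizes act on one space of sequences. They become elements of a single
  ring, whose laws hold without side conditions on sizes.\<close>

typedef (overloaded) 'r lin = "{f :: (nat \<Rightarrow> 'r::comm_ring_1) \<Rightarrow> nat \<Rightarrow> 'r. linear_map f}"
  morphisms app Lin
  by (rule exI[of _ "\<lambda>v. v"]) (simp add: linear_map_def)

setup_lifting type_definition_lin

instantiation lin :: (comm_ring_1) ring
begin

lift_definition zero_lin :: "'a lin" is "\<lambda>v i. 0"
  by (simp add: linear_map_def)

lift_definition plus_lin :: "'a lin \<Rightarrow> 'a lin \<Rightarrow> 'a lin" is "\<lambda>f g v i. f v i + g v i"
  by (simp add: linear_map_def algebra_simps)

lift_definition uminus_lin :: "'a lin \<Rightarrow> 'a lin" is "\<lambda>f v i. - f v i"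
  by (simp add: linear_map_def)

lift_definition minus_lin :: "'a lin \<Rightarrow> 'a lin \<Rightarrow> 'a lin" is "\<lambda>f g v i. f v i - g v i"
  by (simp add: linear_map_def algebra_simps)

lift_definition times_lin :: "'a lin \<Rightarrow> 'a lin \<Rightarrow> 'a lin" is "\<lambda>f g v. f (g v)"
  by (simp add: linear_map_def)

instance
proof
  fix a b c :: "'a lin"
  show "a * (b + c) = a * b + a * c"
    by transfer (simp add: linear_map_def)
qed (transfer; simp add: algebra_simps)+

end

lift_definition scalar :: "'r::comm_ring_1 \<Rightarrow> 'r lin" is "\<lambda>r v i. r * v i"
  by (simp add: linear_map_def algebra_simps)

lemma scalar_simps:
  "f * scalar r = scalar r * f" "scalar (r + s) = scalar r + scalar s"
  "scalar (r * s) = scalar r * scalar s" "scalar 1 * f = f"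
  by (transfer; simp add: linear_map_def algebra_simps)+

text \<open>The matrix is extended by zero to infinitely many rows and columns.\<close>

lift_definition mat_lin :: "nat \<Rightarrow> nat \<Rightarrow> (nat \<Rightarrow> nat \<Rightarrow> 'r) \<Rightarrow> 'r::comm_ring_1 lin"
  is "\<lambda>m n a v k. if k < m then \<Sum>i<n. a k i * v i else 0"
  by (auto simp: linear_map_def algebra_simps sum.distrib sum_distrib_left)

lemma mat_lin_mult: "mat_lin m l a * mat_lin l n b = mat_lin m n (\<lambda>k i. \<Sum>j<l. a k j * b j i)"
proof (transfer, intro ext)
  fix m l n and a b :: "nat \<Rightarrow> nat \<Rightarrow> 'a" and v :: "nat \<Rightarrow> 'a" and k
  show "(if k < m then \<Sum>i<l. a k i * (if i < l then \<Sum>j<n. b i j * v j else 0) else 0) =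
    (if k < m then \<Sum>i<n. (\<Sum>j<l. a k j * b j i) * v i else 0)"
    by (simp add: sum_distrib_left sum_distrib_right mult.assoc) (rule impI, rule sum.swap)
qed

lemma mat_lin_add: "mat_lin m n a + mat_lin m n b = mat_lin m n (\<lambda>k i. a k i + b k i)"
  by transfer (simp add: fun_eq_iff distrib_right sum.distrib)

lemma mat_lin_scalar: "scalar r * mat_lin m n a = mat_lin m n (\<lambda>k i. r * a k i)"
  by transfer (simp add: fun_eq_iff sum_distrib_left mult.assoc)

lemma mat_lin_zero: "mat_lin m n (\<lambda>k i. 0) = 0"
  by transfer (simp add: fun_eq_iff)

lemma mat_lin_eq_iff: "mat_lin m n a = mat_lin m n b \<longleftrightarrow> (\<forall>k<m. \<forall>i<n. a k i = b k i)"
proof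
  assume eq: "mat_lin m n a = mat_lin m n b"
  show "\<forall>k<m. \<forall>i<n. a k i = b k i"
  proof (intro allI impI)
    fix k i assume "k < m" "i < n"
    \<comment> \<open>Evaluation at the standard vector with index \<open>i\<close> reads off column
      \<open>i\<close>.\<close>
    moreover have "app (mat_lin m n a) (\<lambda>j. if j = i then 1 else 0) k = app (mat_lin m n b) (\<lambda>j. if j = i then 1 else 0) k"
      using eq by simp
    ultimately show "a k i = b k i"
      by transfer (simp add: if_distrib[of "\<lambda>x. _ * x"] cong: if_cong)
  qed
next
  show "mat_lin m n a = mat_lin m n b" if "\<forall>k<m. \<forall>i<n. a k i = b k i"
    using that by transfer (auto intro!: ext sum.cong)
qed

section \<open>Units in a discrete valuation ring\<close>

lemma uniformizer_dvd_nonunit: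
  fixes t a :: "'r::idom"
  assumes "discrete_valuation_ring TYPE('r)" "uniformizer t" "\<not> a dvd 1"
  shows "t dvd a"
proof -
  \<comment> \<open>Zorn's lemma will give a maximal ideal containing the nonunit \<open>a\<close>,
    which by uniqueness is generated by \<open>t\<close>. Properness is expressed as
    \<open>1 \<notin> I\<close>, which passes to unions of chains.\<close>
  define \<A> where "\<A> = {I. ring_ideal I \<and> a \<in> I \<and> 1 \<notin> I}"
  have UNIV_iff: "I = UNIV \<longleftrightarrow> 1 \<in> I" if "ring_ideal I" for I :: "'r set"
  proof
    assume "1 \<in> I"
    then have "r * 1 \<in> I" for r
      using that unfolding ring_ideal_def by blast
    then show "I = UNIV"
      by auto
  qed simp
  have gen: "x \<in> generated_ideal a \<longleftrightarrow> a dvd x" for x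
    by (auto simp: generated_ideal_def dvd_def mult.commute)
  then have "ring_ideal (generated_ideal a)" "a \<in> generated_ideal a" "1 \<notin> generated_ideal a"
    using assms(3) by (simp_all add: ring_ideal_def)
  then have "\<A> \<noteq> {}"
    by (auto simp: \<A>_def)
  moreover have "\<Union>\<C> \<in> \<A>" if chain: "\<C> \<noteq> {}" "subset.chain \<A> \<C>" for \<C>
  proof -
    have ideals: "ring_ideal I \<and> a \<in> I \<and> 1 \<notin> I" if "I \<in> \<C>" for I
      using chain(2) that unfolding subset_chain_def \<A>_def by blast
    have "x + y \<in> \<Union>\<C>" if xy: "x \<in> \<Union>\<C>" "y \<in> \<Union>\<C>" for x y
    proof -
      obtain I J where IJ: "I \<in> \<C>" "J \<in> \<C>" "x \<in> I" "y \<in> J"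
        using xy by blast
      then have "I \<subseteq> J \<or> J \<subseteq> I"
        using \<open>subset.chain \<A> \<C>\<close> by (auto simp: subset_chain_def)
      then obtain K where "K \<in> \<C>" "x \<in> K" "y \<in> K"
        using IJ by blast
      moreover have "ring_ideal K"
        using ideals[OF \<open>K \<in> \<C>\<close>] by blast
      ultimately show ?thesis
        unfolding ring_ideal_def by blast
    qed
    moreover have "0 \<in> \<Union>\<C>" "a \<in> \<Union>\<C>" "1 \<notin> \<Union>\<C>"
      using chain(1) ideals unfolding ring_ideal_def by blast+
    moreover have "r * x \<in> \<Union>\<C>" if "x \<in> \<Union>\<C>" for r x
      using ideals that unfolding ring_ideal_def by blast
    ultimately show ?thesis
      by (simp add: \<A>_def ring_ideal_def)
  qed
  ultimately obtain M where M: "M \<in> \<A>" "\<And>I. I \<in> \<A> \<Longrightarrow> M \<subseteq> I \<Longrightarrow> I = M"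
    using subset_Zorn_nonempty[of \<A>] by blast
  have "maximal_ring_ideal M"
    unfolding maximal_ring_ideal_def
  proof (intro conjI allI impI)
    show "ring_ideal M" "M \<noteq> UNIV"
      using M(1) by (auto simp: \<A>_def)
    show "I = M \<or> I = UNIV" if "ring_ideal I" "M \<subseteq> I" for I
      using M that UNIV_iff[OF that(1)] by (auto simp: \<A>_def)
  qed
  moreover have "\<exists>!M :: 'r set. maximal_ring_ideal M"
    using assms(1) unfolding discrete_valuation_ring_def by blast
  ultimately have "M = generated_ideal t"
    using assms(2) unfolding uniformizer_def by blast
  then show ?thesis
    using M(1) by (auto simp: \<A>_def generated_ideal_def)
qed

lemma uniformizer_nonunit:
  fixes t :: "'r::idom"
  assumes "uniformizer t"
  shows "\<not> t dvd 1"
proof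
  assume "t dvd 1"
  then obtain s where "1 = t * s"
    by (auto simp: dvd_def)
  then have "r = (r * s) * t" for r
    by (simp add: mult_ac)
  then have "r \<in> generated_ideal t" for r
    unfolding generated_ideal_def by blast
  then have "generated_ideal t = UNIV"
    by blast
  then show False
    using assms by (auto simp: uniformizer_def maximal_ring_ideal_def)
qed

text \<open>The ring has a nonzero nonunit, and \<open>t\<close> divides it.\<close>

lemma uniformizer_nonzero:
  fixes t :: "'r::idom"
  assumes "discrete_valuation_ring TYPE('r)" "uniformizer t"
  shows "t \<noteq> 0"
  using uniformizer_dvd_nonunit[OF assms] assms(1) by (auto simp: discrete_valuation_ring_def)

text \<open>If \<open>a\<close> and \<open>1 - a\<close> were both nonunits, \<open>t\<close> would
  divide their sum 1. Likewise, a nonunit norm would make \<open>t\<close> divide the unit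
  \<open>a * a\<close>.\<close>

lemma dvr_local:
  fixes t a b :: "'r::idom"
  assumes "discrete_valuation_ring TYPE('r)" "uniformizer t"
  shows "a dvd 1 \<or> 1 - a dvd 1"
    and "a dvd 1 \<Longrightarrow> a * a - t * (b * b) dvd 1"
proof -
  show "a dvd 1 \<or> 1 - a dvd 1"
    using uniformizer_dvd_nonunit[OF assms] uniformizer_nonunit[OF assms(2)]
    by (metis diff_add_cancel dvd_add)
  show "a * a - t * (b * b) dvd 1" if "a dvd 1"
  proof (rule ccontr)
    assume "\<not> ?thesis"
    then have "t dvd a * a - t * (b * b)"
      by (rule uniformizer_dvd_nonunit[OF assms])
    then have "t dvd a * a"
      by (metis diff_add_cancel dvd_add dvd_triv_left)
    moreover have "a * a dvd 1"
      using that by (metis mult_dvd_mono mult_1)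
    ultimately show False
      using uniformizer_nonunit[OF assms(2)] by (metis dvd_trans)
  qed
qed

section \<open>Matrix factorizations over a cyclic poset\<close>

lemma sum_if_eq:
  fixes f :: "nat \<Rightarrow> 'r::comm_ring_1"
  shows "(\<Sum>j<l. (if a = j then 1 else 0) * f j) = (if a < l then f a else 0)"
    and "(\<Sum>j<l. (if k = n + j then 1 else 0) * f j) = (if n \<le> k \<and> k - n < l then f (k - n) else 0)"
proof -
  show *: "(\<Sum>j<l. (if a = j then 1 else 0) * f j) = (if a < l then f a else 0)" for a
    by (simp add: if_distrib[of "\<lambda>x. x * _"] cong: if_cong)
  show "(\<Sum>j<l. (if k = n + j then 1 else 0) * f j) = (if n \<le> k \<and> k - n < l then f (k - n) else 0)"
  proof (cases "n \<le> k")
    case True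
    then have "k = n + j \<longleftrightarrow> k - n = j" for j
      by auto
    then show ?thesis
      using True *[of "k - n"] by simp
  qed auto
qed

lemma sum_list_mat_lin:
  "(\<Sum>x\<leftarrow>xs. mat_lin m n (a x)) = mat_lin m n (\<lambda>k i. \<Sum>x\<leftarrow>xs. a x k i)"
  by (induction xs) (simp_all add: mat_lin_zero mat_lin_add)

lemma mat_lin_eq_0_iff: "mat_lin m n a = 0 \<longleftrightarrow> (\<forall>k<m. \<forall>i<n. a k i = 0)"
  using mat_lin_eq_iff[of m n a "\<lambda>k i. 0"] by (simp add: mat_lin_zero)

lemma hom_sum_RX: "hom_sum (RX t X c) x y (map f [0..<n]) = (\<Sum>j<n. f j)"
proof -
  have "hom_sum (RX t X c) x y fs = sum_list fs" for fs
    by (induction fs) (simp_all add: hom_sum_def RX_def)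
  then show ?thesis
    by (simp add: interv_sum_list_conv_sum_set_nat atLeast0LessThan)
qed

lemma Obj_PX: "Obj (PX t X c) = {xs. set xs \<subseteq> X}"
  by (simp add: PX_def add_cat_def RX_def)

lemma Hom_PX: "Hom (PX t X c) P Q = carrier_mat (length Q) (length P)"
  by (auto simp: PX_def add_cat_def RX_def)

lemma PX_simps:
  "Idn (PX t X c) P = mat (length P) (length P) (\<lambda>(k, i). if k = i then 1 else 0)"
  "Comp (PX t X c) P Q S N M = mat (length S) (length P)
     (\<lambda>(k, i). \<Sum>j<length Q. N $$ (k, j) * M $$ (j, i) * t ^ c (P ! i) (Q ! j) (S ! k))"
  "Zero (PX t X c) P Q = mat (length Q) (length P) (\<lambda>(k, i). 0)"
  "Plus (PX t X c) P Q M M' = mat (length Q) (length P) (\<lambda>(k, i). M $$ (k, i) + M' $$ (k, i))"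
  "Scale (PX t X c) P Q r M = mat (length Q) (length P) (\<lambda>(k, i). r * M $$ (k, i))"
  by (simp_all add: PX_def add_cat_def hom_sum_RX) (auto intro!: eq_matI simp: RX_def)

locale cyclic_poset_dvr =
  fixes t :: "'r::idom" and X :: "'x set" and c :: "'x \<Rightarrow> 'x \<Rightarrow> 'x \<Rightarrow> nat"
  assumes dvr: "discrete_valuation_ring TYPE('r)" and uniformizer: "uniformizer t"
    and cyclic: "cyclic_poset X c"
begin

section \<open>Untwisting the composition\<close>

definition base :: 'x where
  "base = (SOME x. x \<in> X)"

text \<open>The cochain \<open>c base\<close> has \<open>c\<close> as its coboundary, so rescaling
  matrix entries by this weight removes the twist. For empty \<open>X\<close> the point
  \<open>base\<close> is arbitrary, but then lists over \<open>X\<close> have no entries.\<close>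

definition weight :: "'x \<Rightarrow> 'x \<Rightarrow> 'r" where
  "weight x y = t ^ c base x y"

text \<open>Over a domain this makes rescaling injective, so the ring element of a matrix determines
  its entries.\<close>

lemma weight_nonzero: "weight x y \<noteq> 0"
  using uniformizer_nonzero[OF dvr uniformizer] by (simp add: weight_def)

lemma base_in: "x \<in> X \<Longrightarrow> base \<in> X"
  unfolding base_def by (rule someI)

lemma weight_self: "x \<in> X \<Longrightarrow> weight x x = 1"
  using cyclic base_in by (simp add: weight_def cyclic_poset_def)

text \<open>This is the cocycle identity at \<open>base\<close>, \<open>x\<close>, \<open>y\<close>,
  \<open>z\<close>, written without subtraction in the exponent of \<open>t\<close>.\<close>

lemma weight_mult:
  assumes "x \<in> X" "y \<in> X" "z \<in> X"
  shows "t ^ c x y z * weight x z = weight y z * weight x y"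
proof -
  have "int (c x y z) - int (c base y z) + int (c base x z) - int (c base x y) = 0"
    using cyclic assms base_in[OF assms(1)] unfolding cyclic_poset_def by blast
  then have "c x y z + c base x z = c base y z + c base x y"
    by linarith
  then show ?thesis
    by (simp add: weight_def flip: power_add)
qed

definition lin_of :: "'x list \<Rightarrow> 'x list \<Rightarrow> (nat \<Rightarrow> nat \<Rightarrow> 'r) \<Rightarrow> 'r lin" where
  "lin_of P Q a = mat_lin (length Q) (length P) (\<lambda>k i. a k i * weight (P ! i) (Q ! k))"

definition Ob :: "'x list set" where
  "Ob = {P. set P \<subseteq> X}"

definition arrows :: "'x list \<Rightarrow> 'x list \<Rightarrow> 'r lin set" where
  "arrows P Q = (if P \<in> Ob \<and> Q \<in> Ob then range (lin_of P Q) else {})"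

definition unit :: "'x list \<Rightarrow> 'r lin" where
  "unit P = mat_lin (length P) (length P) (\<lambda>k i. if k = i then 1 else 0)"

definition rep :: "'x list \<Rightarrow> 'x list \<Rightarrow> 'r mat \<Rightarrow> 'r lin" where
  "rep P Q M = lin_of P Q (\<lambda>k i. M $$ (k, i))"

lemma nth_Ob: "\<lbrakk>P \<in> Ob; i < length P\<rbrakk> \<Longrightarrow> P ! i \<in> X"
  by (auto simp: Ob_def)

lemma lin_of_eq_iff: "lin_of P Q a = lin_of P Q b \<longleftrightarrow> (\<forall>k<length Q. \<forall>i<length P. a k i = b k i)"
  by (simp add: lin_of_def mat_lin_eq_iff weight_nonzero)

lemma lin_of_mult:
  assumes "P \<in> Ob" "Q \<in> Ob" "S \<in> Ob"
  shows "lin_of Q S a * lin_of P Q b =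
    lin_of P S (\<lambda>k i. \<Sum>j<length Q. a k j * b j i * t ^ c (P ! i) (Q ! j) (S ! k))"
  using assms
  by (auto simp: lin_of_def mat_lin_mult mat_lin_eq_iff sum_distrib_right mult.assoc nth_Ob weight_mult
      intro!: sum.cong)

lemma lin_of_eq_0_iff: "lin_of P Q a = 0 \<longleftrightarrow> (\<forall>k<length Q. \<forall>i<length P. a k i = 0)"
  by (simp add: lin_of_def mat_lin_eq_0_iff weight_nonzero)

lemma lin_of_add: "lin_of P Q a + lin_of P Q b = lin_of P Q (\<lambda>k i. a k i + b k i)"
  by (simp add: lin_of_def mat_lin_add mat_lin_eq_iff algebra_simps)

lemma lin_of_scalar: "scalar r * lin_of P Q a = lin_of P Q (\<lambda>k i. r * a k i)"
  by (simp add: lin_of_def mat_lin_scalar mult.assoc)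

text \<open>Since \<open>weight x x = 1\<close>, rescaling leaves a 0-1 matrix unchanged when its
  ones join equal points. This covers identities, inclusions and projections.\<close>

lemma lin_of_indicator:
  assumes "P \<in> Ob" "\<And>k i. \<lbrakk>\<phi> k i; k < length Q; i < length P\<rbrakk> \<Longrightarrow> P ! i = Q ! k"
  shows "mat_lin (length Q) (length P) (\<lambda>k i. if \<phi> k i then 1 else 0) =
    lin_of P Q (\<lambda>k i. if \<phi> k i then 1 else 0)"
  using assms by (auto simp: lin_of_def mat_lin_eq_iff) (metis nth_Ob weight_self)

lemma indicator_arrows:
  assumes "P \<in> Ob" "Q \<in> Ob" "\<And>k i. \<lbrakk>\<phi> k i; k < length Q; i < length P\<rbrakk> \<Longrightarrow> P ! i = Q ! k"
  shows "mat_lin (length Q) (length P) (\<lambda>k i. if \<phi> k i then 1 else 0) \<in> arrows P Q"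
  using lin_of_indicator[of P \<phi> Q] assms by (auto simp: arrows_def)

lemma arrowsE:
  assumes "f \<in> arrows P Q"
  obtains a where "P \<in> Ob" "Q \<in> Ob" "f = lin_of P Q a"
  using assms by (auto simp: arrows_def split: if_splits)

lemma lin_of_in: "\<lbrakk>P \<in> Ob; Q \<in> Ob\<rbrakk> \<Longrightarrow> lin_of P Q a \<in> arrows P Q"
  by (simp add: arrows_def)

sublocale ring_category Ob arrows unit scalar
proof (unfold_locales, goal_cases)
  case (2 P)
  then show ?case
    by (auto simp: unit_def intro!: indicator_arrows)
next
  case (3 P Q)
  then show ?case
    using lin_of_in[of P Q "\<lambda>k i. 0"] lin_of_eq_0_iff[of P Q "\<lambda>k i. 0"] by simp
next
  case (7 f P Q)
  then show ?case
    by (auto elim!: arrowsE simp: lin_of_def unit_def mat_lin_mult mat_lin_eq_iff sum_if_eq)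
next
  case (8 f P Q)
  have "(\<Sum>j<n. a j * (if j = i then 1 else 0)) = (if i < n then a i else 0)" for a :: "nat \<Rightarrow> 'r" and n i
    using sum_if_eq(1)[of i a n] by (simp add: mult.commute eq_commute[of i])
  with 8 show ?case
    by (auto elim!: arrowsE simp: lin_of_def unit_def mat_lin_mult mat_lin_eq_iff)
qed (rule scalar_simps |
    (auto elim!: arrowsE simp: lin_of_mult lin_of_add lin_of_scalar lin_of_in)[1])+

lemma biprod_append:
  assumes "P \<in> Ob" "Q \<in> Ob"
  defines "n \<equiv> length P" and "m \<equiv> length Q"
  shows "biprod P Q (P @ Q)
    (mat_lin (n + m) n (\<lambda>k i. if k = i then 1 else 0)) (mat_lin (n + m) m (\<lambda>k i. if k = n + i then 1 else 0))
    (mat_lin n (n + m) (\<lambda>k i. if k = i then 1 else 0)) (mat_lin m (n + m) (\<lambda>k i. if n + k = i then 1 else 0))"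
proof -
  have "P @ Q \<in> Ob"
    using assms by (auto simp: Ob_def)
  then have "mat_lin (n + m) n (\<lambda>k i. if k = i then 1 else 0) \<in> arrows P (P @ Q)"
    "mat_lin (n + m) m (\<lambda>k i. if k = n + i then 1 else 0) \<in> arrows Q (P @ Q)"
    "mat_lin n (n + m) (\<lambda>k i. if k = i then 1 else 0) \<in> arrows (P @ Q) P"
    "mat_lin m (n + m) (\<lambda>k i. if n + k = i then 1 else 0) \<in> arrows (P @ Q) Q"
    using assms indicator_arrows[of P "P @ Q" "\<lambda>k i. k = i"] indicator_arrows[of Q "P @ Q" "\<lambda>k i. k = n + i"]
      indicator_arrows[of "P @ Q" P "\<lambda>k i. k = i"] indicator_arrows[of "P @ Q" Q "\<lambda>k i. n + k = i"]
    by (auto simp: nth_append)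
  then show ?thesis
    by (simp add: biprod_def unit_def mat_lin_mult sum_if_eq mat_lin_add mat_lin_eq_iff
        mat_lin_eq_0_iff n_def[symmetric] m_def[symmetric]) auto
qed

section \<open>Embedding of the additive category into the ring\<close>

lemma PX_rep:
  assumes "P \<in> Ob" "Q \<in> Ob" "S \<in> Ob"
  shows "rep P P (Idn (PX t X c) P) = unit P"
    and "rep P S (Comp (PX t X c) P Q S N M) = rep Q S N * rep P Q M"
    and "rep P Q (Zero (PX t X c) P Q) = 0"
    and "rep P Q (Plus (PX t X c) P Q M M') = rep P Q M + rep P Q M'"
    and "rep P Q (Scale (PX t X c) P Q r M) = scalar r * rep P Q M"
proof -
  show "rep P P (Idn (PX t X c) P) = unit P"
    using assms lin_of_indicator[of P "\<lambda>k i. k = i" P] by (simp add: rep_def PX_simps unit_def lin_of_eq_iff)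
qed (use assms in \<open>simp_all add: rep_def PX_simps lin_of_mult lin_of_add lin_of_scalar
  lin_of_eq_iff lin_of_eq_0_iff\<close>)

lemma rep_bij:
  assumes "P \<in> Ob" "Q \<in> Ob"
  shows "bij_betw (rep P Q) (Hom (PX t X c) P Q) (arrows P Q)"
  unfolding bij_betw_def
proof
  show "inj_on (rep P Q) (Hom (PX t X c) P Q)"
    by (auto simp: inj_on_def rep_def lin_of_eq_iff Hom_PX)
  have "lin_of P Q a \<in> rep P Q ` Hom (PX t X c) P Q" for a
  proof
    show "lin_of P Q a = rep P Q (mat (length Q) (length P) (\<lambda>(k, i). a k i))"
      by (simp add: rep_def lin_of_eq_iff)
  qed (simp add: Hom_PX)
  then show "rep P Q ` Hom (PX t X c) P Q = arrows P Q"
    using assms by (auto simp: arrows_def rep_def)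
qed

lemma rep_in: "\<lbrakk>P \<in> Ob; Q \<in> Ob\<rbrakk> \<Longrightarrow> rep P Q M \<in> arrows P Q"
  by (simp add: rep_def lin_of_in)

lemma rep_eq_iff:
  "\<lbrakk>P \<in> Ob; Q \<in> Ob; M \<in> Hom (PX t X c) P Q; N \<in> Hom (PX t X c) P Q\<rbrakk> \<Longrightarrow> M = N \<longleftrightarrow> rep P Q M = rep P Q N"
  using bij_betw_imp_inj_on[OF rep_bij] by (auto dest: inj_onD)

lemma PX_closed:
  "Idn (PX t X c) P \<in> Hom (PX t X c) P P" "Comp (PX t X c) P Q S N M \<in> Hom (PX t X c) P S"
  "Zero (PX t X c) P Q \<in> Hom (PX t X c) P Q" "Plus (PX t X c) P Q M M' \<in> Hom (PX t X c) P Q"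
  "Scale (PX t X c) P Q r M \<in> Hom (PX t X c) P Q"
  by (simp_all add: Hom_PX PX_simps)

section \<open>Matrix factorizations inside the ring\<close>

definition mdif :: "'x list \<times> 'r mat \<Rightarrow> 'r lin" where
  "mdif A = rep (fst A) (fst A) (snd A)"

lemma MF_Obj_iff: "A \<in> Obj (MF t X c) \<longleftrightarrow> fst A \<in> Ob \<and> snd A \<in> Hom (PX t X c) (fst A) (fst A) \<and>
    mdif A * mdif A = scalar t * unit (fst A)"
proof (cases A)
  case (Pair P d)
  have "P \<in> Ob \<Longrightarrow> Comp (PX t X c) P P P d d = Scale (PX t X c) P P t (Idn (PX t X c) P) \<longleftrightarrow>
      rep P P d * rep P P d = scalar t * unit P"
    by (simp add: rep_eq_iff[of P P] PX_closed PX_rep)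
  then show ?thesis
    by (auto simp: Pair MF_def mf_cat_def mdif_def Ob_def Obj_PX)
qed

text \<open>The identity matrix is the sum of its diagonal matrix units, and the one with index
  \<open>i\<close> factors through the singleton list \<open>[P ! i]\<close>.\<close>

lemma one_decomposition_PX:
  assumes "P \<in> Ob"
  shows "\<exists>xs. (\<forall>(Y, u, g)\<in>set xs. Y \<in> {[x] |x. x \<in> X} \<and> u \<in> arrows Y P \<and> g \<in> arrows P Y) \<and>
    unit P = (\<Sum>(Y, u, g)\<leftarrow>xs. u * g)"
proof -
  let ?u = "\<lambda>i. mat_lin (length P) 1 (\<lambda>k j. if k = i then 1 else 0) :: 'r lin"
  let ?g = "\<lambda>i. mat_lin 1 (length P) (\<lambda>k j. if i = j then 1 else 0) :: 'r lin"
  let ?xs = "map (\<lambda>i. ([P ! i], ?u i, ?g i)) [0..<length P]"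
  have "[P ! i] \<in> {[x] |x. x \<in> X} \<and> ?u i \<in> arrows [P ! i] P \<and> ?g i \<in> arrows P [P ! i]" if "i < length P" for i
  proof (intro conjI)
    have i: "P ! i \<in> X"
      using assms that by (rule nth_Ob)
    then show "[P ! i] \<in> {[x] |x. x \<in> X}"
      by blast
    have "[P ! i] \<in> Ob"
      using i by (simp add: Ob_def)
    then have "mat_lin (length P) (length [P ! i]) (\<lambda>k j. if k = i then 1 else 0) \<in> arrows [P ! i] P"
      "mat_lin (length [P ! i]) (length P) (\<lambda>k j. if i = j then 1 else 0) \<in> arrows P [P ! i]"
      using assms by (intro indicator_arrows; simp)+
    then show "?u i \<in> arrows [P ! i] P" "?g i \<in> arrows P [P ! i]"
      by simp_all
  qed
  moreover have "(\<Sum>(Y, u, g)\<leftarrow>?xs. u * g) =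
      (\<Sum>i\<leftarrow>[0..<length P]. mat_lin (length P) (length P) (\<lambda>k j. (if k = i then 1 else 0) * (if i = j then 1 else 0)))"
    by (simp add: o_def mat_lin_mult)
  then have "unit P = (\<Sum>(Y, u, g)\<leftarrow>?xs. u * g)"
    unfolding sum_list_mat_lin
    by (simp add: unit_def mat_lin_eq_iff interv_sum_list_conv_sum_set_nat atLeast0LessThan sum_if_eq)
  ultimately show ?thesis
    by (intro exI[of _ ?xs]) auto
qed

sublocale local_factorizations Ob arrows unit scalar t "Obj (MF t X c)" fst mdif "{[x] |x. x \<in> X}"
proof (unfold_locales, goal_cases)
  case 1
  have "unit [] = 0"
    by (simp add: unit_def mat_lin_eq_0_iff)
  then show ?case
    by (intro bexI[of _ "[]"]) (auto simp: Ob_def)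
next
  case (2 P Q)
  then show ?case
    using biprod_append by blast
next
  case (6 P \<delta>)
  then obtain d where "d \<in> Hom (PX t X c) P P" "\<delta> = rep P P d"
    using bij_betw_imp_surj_on[OF rep_bij[of P P]] by blast
  with 6 show ?case
    by (intro bexI[of _ "(P, d)"]) (auto simp: MF_Obj_iff mdif_def)
next
  case (7 Y f)
  then obtain x a where "x \<in> X" "Y = [x]" "f = lin_of [x] [x] a"
    by (auto elim!: arrowsE)
  \<comment> \<open>An endomorphism of a singleton has a single entry, and its weight is 1.\<close>
  then show ?case
    by (intro exI[of _ "a 0 0"]) (simp add: lin_of_def unit_def mat_lin_scalar mat_lin_eq_iff weight_self)
next
  case (8 P)
  then show ?case
    by (rule one_decomposition_PX)
qed (use dvr_local[OF dvr uniformizer] in \<open>auto simp: MF_Obj_iff mdif_def rep_in\<close>)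

lemma MF_Hom:
  assumes "A \<in> Obj (MF t X c)" "B \<in> Obj (MF t X c)"
  shows "Hom (MF t X c) A B = {f \<in> Hom (PX t X c) (fst A) (fst B). rep (fst A) (fst B) f \<in> MH A B}"
proof -
  have "fst A \<in> Ob" "fst B \<in> Ob"
    using assms by (auto simp: MF_Obj_iff)
  then have "Comp (PX t X c) (fst A) (fst B) (fst B) (snd B) f = Comp (PX t X c) (fst A) (fst A) (fst B) f (snd A) \<longleftrightarrow>
      rep (fst A) (fst B) f \<in> MH A B" for f
    by (simp add: rep_eq_iff[of "fst A" "fst B"] PX_closed PX_rep mdif_def MH_def rep_in)
  then show ?thesis
    by (simp add: MF_def mf_cat_def case_prod_unfold)
qed

lemma MF_simps:
  "Idn (MF t X c) A = Idn (PX t X c) (fst A)"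
  "Comp (MF t X c) A B D = Comp (PX t X c) (fst A) (fst B) (fst D)"
  "Zero (MF t X c) A B = Zero (PX t X c) (fst A) (fst B)"
  "Plus (MF t X c) A B = Plus (PX t X c) (fst A) (fst B)"
  by (simp_all add: MF_def mf_cat_def case_prod_unfold)

lemma MF_exact_iff:
  assumes "A \<in> Obj (MF t X c)" "B \<in> Obj (MF t X c)" "D \<in> Obj (MF t X c)"
    and "f \<in> Hom (MF t X c) A B" "g \<in> Hom (MF t X c) B D"
  shows "MF_exact t X c A B D f g \<longleftrightarrow> mf_exact A B D (rep (fst A) (fst B) f) (rep (fst B) (fst D) g)"
proof -
  obtain P Q S where PQS: "fst A = P" "fst D = Q" "fst B = S" "P \<in> Ob" "Q \<in> Ob" "S \<in> Ob"
    using assms by (auto simp: MF_Obj_iff)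
  have fg: "f \<in> Hom (PX t X c) P S" "g \<in> Hom (PX t X c) S Q"
    using assms PQS by (auto simp: MF_Hom)
  have iff: "is_biproduct (PX t X c) P Q S f s r g \<longleftrightarrow> s \<in> Hom (PX t X c) Q S \<and> r \<in> Hom (PX t X c) S P \<and>
      biprod P Q S (rep P S f) (rep Q S s) (rep S P r) (rep S Q g)" for s r
    using PQS(4-6) fg
    by (auto simp: is_biproduct_def biprod_def rep_in PX_rep PX_closed rep_eq_iff[of P P] rep_eq_iff[of P Q]
        rep_eq_iff[of Q P] rep_eq_iff[of Q Q] rep_eq_iff[of S S] Obj_PX Ob_def)
  have "(\<exists>s' r'. biprod P Q S (rep P S f) s' r' (rep S Q g)) \<longleftrightarrow> split_exact (PX t X c) P S Q f g"
  proof
    assume "\<exists>s' r'. biprod P Q S (rep P S f) s' r' (rep S Q g)"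
    then obtain s' r' where b: "biprod P Q S (rep P S f) s' r' (rep S Q g)"
      by blast
    then have "s' \<in> arrows Q S" "r' \<in> arrows S P"
      by (auto simp: biprod_def)
    \<comment> \<open>Section and retraction in the ring come from matrices because
      \<open>rep\<close> maps onto \<open>arrows\<close>.\<close>
    then obtain s r where "s \<in> Hom (PX t X c) Q S" "r \<in> Hom (PX t X c) S P" "s' = rep Q S s" "r' = rep S P r"
      using bij_betw_imp_surj_on[OF rep_bij] PQS(4-6) by blast
    with b iff show "split_exact (PX t X c) P S Q f g"
      unfolding split_exact_def by blast
  qed (use iff in \<open>auto simp: split_exact_def\<close>)
  then show ?thesis
    using assms PQS by (auto simp: MF_exact_def mf_exact_def MF_Hom)
qed

interpretation iso: category_iso "MF t X c" mf "\<lambda>A B. rep (fst A) (fst B)" "MF_exact t X c" mf_exact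
proof (unfold_locales, goal_cases)
  case (2 A B)
  then have AB: "fst A \<in> Ob" "fst B \<in> Ob"
    by (auto simp: MF_Obj_iff)
  have "MH A B \<subseteq> rep (fst A) (fst B) ` Hom (PX t X c) (fst A) (fst B)"
    using bij_betw_imp_surj_on[OF rep_bij[OF AB]] by (auto simp: MH_def)
  then show ?case
    using bij_betw_imp_inj_on[OF rep_bij[OF AB]] 2 by (auto simp: MF_Hom bij_betw_def inj_on_def)
next
  case (3 A)
  then show ?case
    using MH_one[OF 3] PX_rep(1)[OF und_Ob[OF 3] und_Ob[OF 3] und_Ob[OF 3]]
    by (simp add: MF_simps MF_Hom PX_closed)
next
  case (11 A B D f g)
  then show ?case
    by (simp add: MF_exact_def)
next
  case (12 A B D f g)
  then show ?case
    by (simp add: mf_exact_def)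
next
  case (13 A B D f g)
  then show ?case
    by (rule MF_exact_iff)
qed (auto simp: MF_simps MF_Hom PX_closed PX_rep MF_Obj_iff intro!: MH_mult MH_add)

section \<open>The objects \<open>GP\<close> and the projective-injective objects\<close>

lemma is_double_GP:
  assumes "P \<in> Ob"
  shows "\<exists>i\<^sub>1 i\<^sub>2 p\<^sub>1 p\<^sub>2. is_double P (GP t X c P) i\<^sub>1 i\<^sub>2 p\<^sub>1 p\<^sub>2"
proof -
  define n where "n = length P"
  let ?i\<^sub>1 = "mat_lin (n + n) n (\<lambda>k i. if k = i then 1 else 0) :: 'r lin"
  let ?i\<^sub>2 = "mat_lin (n + n) n (\<lambda>k i. if k = n + i then 1 else 0) :: 'r lin"
  let ?p\<^sub>1 = "mat_lin n (n + n) (\<lambda>k i. if k = i then 1 else 0) :: 'r lin"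
  let ?p\<^sub>2 = "mat_lin n (n + n) (\<lambda>k i. if n + k = i then 1 else 0) :: 'r lin"
  have b: "biprod P P (P @ P) ?i\<^sub>1 ?i\<^sub>2 ?p\<^sub>1 ?p\<^sub>2"
    using biprod_append[OF assms assms] by (simp add: n_def)
  have PP: "P @ P \<in> Ob"
    using biprodD(7)[OF b] .
  have "mdif (GP t X c P) = ?i\<^sub>2 * ?p\<^sub>1 + scalar t * (?i\<^sub>1 * ?p\<^sub>2)"
    unfolding mdif_def rep_def lin_of_def GP_def fst_conv snd_conv mat_lin_mult mat_lin_scalar mat_lin_add
      length_append n_def[symmetric] mat_lin_eq_iff
  proof (intro allI impI)
    \<comment> \<open>The nonzero entries join a point of \<open>P\<close> to its own copy in the
      other half, so their weight is 1 and the entries 1 and \<open>t\<close> survive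
      unchanged.\<close>
    fix k i assume "k < n + n" "i < n + n"
    then show "four_block_mat (Zero (PX t X c) P P) (Scale (PX t X c) P P t (Idn (PX t X c) P))
          (Idn (PX t X c) P) (Zero (PX t X c) P P) $$ (k, i) * weight ((P @ P) ! i) ((P @ P) ! k) =
        (\<Sum>j<n. (if k = n + j then 1 else 0) * (if j = i then 1 else 0)) +
        t * (\<Sum>j<n. (if k = j then 1 else 0) * (if n + j = i then 1 else 0))"
      unfolding sum_if_eq using nth_Ob[OF assms]
      by (auto simp: PX_simps nth_append weight_self n_def)
  qed
  moreover from this double_square[OF b] have "GP t X c P \<in> Obj (MF t X c)"
    using PP by (simp add: MF_Obj_iff GP_def Hom_PX PX_simps four_block_carrier_mat)
  moreover have "fst (GP t X c P) = P @ P"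
    by (simp add: GP_def)
  ultimately show ?thesis
    using b unfolding is_double_def by metis
qed

lemma contractible_iff_GP:
  "contractible A \<longleftrightarrow> (\<exists>P\<in>Ob. isomorphic mf A (GP t X c P))"
proof
  assume "contractible A"
  then show "\<exists>P\<in>Ob. isomorphic mf A (GP t X c P)"
    using contractible_isomorphic_double is_double_GP by blast
next
  assume "\<exists>P\<in>Ob. isomorphic mf A (GP t X c P)"
  then show "contractible A"
    using contractible_iso contractible_double is_double_GP by blast
qed

lemma frobenius_MF: "frobenius_category (MF t X c) (MF_exact t X c)"
  by (rule iso.frobenius_map[OF frobenius_mf])

text \<open>Projectivity, injectivity and being isomorphic to some \<open>GP\<close> are moved to
  the ring model, where each of them amounts to contractibility.\<close>

lemma projective_injective_MF:
  "{A \<in> Obj (MF t X c). projective_object (MF t X c) (MF_exact t X c) A \<and>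
      injective_object (MF t X c) (MF_exact t X c) A} =
    {A \<in> Obj (MF t X c). \<exists>P \<in> Obj (PX t X c). isomorphic (MF t X c) A (GP t X c P)}"
proof -
  have "Obj (PX t X c) = Ob"
    by (simp add: Obj_PX Ob_def)
  then show ?thesis
    unfolding iso.projective_map[symmetric] iso.injective_map[symmetric] iso.isomorphic_map[symmetric]
      projective_iff_contractible injective_iff_contractible contractible_iff_GP by simp
qed

end

theorem theorem1p3p3:
  fixes t :: "'r::idom" and X :: "'x set" and c :: "'x \<Rightarrow> 'x \<Rightarrow> 'x \<Rightarrow> nat"
  assumes "discrete_valuation_ring TYPE('r)" and "uniformizer t" and "cyclic_poset X c"
  shows "frobenius_category (MF t X c) (MF_exact t X c) \<and>
    {A \<in> Obj (MF t X c). projective_object (MF t X c) (MF_exact t X c) A \<and>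
                         injective_object (MF t X c) (MF_exact t X c) A} =
    {A \<in> Obj (MF t X c). \<exists>P \<in> Obj (PX t X c). isomorphic (MF t X c) A (GP t X c P)}"
proof -
  interpret cyclic_poset_dvr t X c
    using assms by unfold_locales
  show ?thesis
    using frobenius_MF projective_injective_MF by blast
qed

end
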